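(* Let $a,b,c\in(0,1)$. The negative switching class (the matrix $G_-(a,b,c)$) is feasible precisely when $\Delta_-\ge0$, and its feasibility implies feasibility of the positive class. If $\Delta_-<0$, every realizable triple $n_1,n_2,n_3\in S^2$ with $|n_1\cdot n_2|=a$, $|n_1\cdot n_3|=b$, $|n_2\cdot n_3|=c$ has positive triangle sign $\operatorname{sgn}(\rho_{12}\rho_{13}\rho_{23})=+1$, where $\rho_{ij}=n_i\cdot n_j$. If $\Delta_-\ge0$, then $$J_+(a,b,c)-J_-(a,b,c)=\frac{1}{4\pi}\int_0^a\int_0^b\int_{-c}^{c}\frac{dz\,dy\,dx}{\sqrt{1-x^2-y^2-z^2+2xyz}}.$$ In particular, $J_+(a,b,c)>J_-(a,b,c)$ and $$J_+(a,b,c)-J_-(a,b,c)\ge\frac{abc}{2\pi}.$$ Thus the labelled data $\left(|\rho_{12}|,|\rho_{13}|,|\rho_{23}|,I_3(n_1,n_2,n_3)\right)$ determine $\operatorname{sgn}(\rho_{12}\rho_{13}\rho_{23})$ uniquely whenever all three correlations are nonzero.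
   Context: For $a,b,c\in(0,1)$ put $$G_\pm(a,b,c)=\begin{pmatrix} 1 & a & b \\ a & 1 & \pm c \\ b & \pm c & 1 \end{pmatrix},\qquad\Delta_\pm=1-a^2-b^2-c^2\pm2abc.$$ A class ($+$ or $-$) is feasible if the corresponding matrix $G_\pm(a,b,c)$ is positive semidefinite (equivalently, is the Gram matrix of three unit vectors in $\mathbb{R}^3$). For $n_1,n_2,n_3\in S^2$, $I_3(n_1,n_2,n_3)=\mathbb{E}\left(|U\cdot n_1||U\cdot n_2||U\cdot n_3|\right)$ with $U$ uniformly distributed on $S^2$; this depends only on the Gram matrix of $(n_1,n_2,n_3)$. Whenever $G_\pm(a,b,c)$ is positive semidefinite, $J_\pm(a,b,c)$ denotes the value of $I_3$ for three unit vectors with Gram matrix $G_\pm(a,b,c)$. On the boundary $\Delta_-=0$ the triple integral is understood as an improper integral. "Correlations" means the numbers $\rho_{ij}=n_i\cdot n_j$; in the final assertion they are assumed to satisfy $|\rho_{ij}|\in(0,1)$. *)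

theory Defs
  imports "HOL-Analysis.Analysis" "HOL-Probability.Probability"
begin

text \<open>
  The uniform distribution on $S^2$, as the law of $X / |X|$ for $X$ uniform in the unit ball
  (\<^const>\<open>sgn\<close> is $x \mapsto x / |x|$ on a normed space).  The lemmas below confirm that it
  is a probability measure, carried by the sphere and invariant under orthogonal maps; these
  properties characterise the normalised surface measure.
\<close>

definition uniform_sphere :: "(real^3) measure" where
  "uniform_sphere = distr (uniform_measure lborel (ball 0 1)) borel sgn"

lemma sgn_borel_measurable: "(sgn :: real^3 \<Rightarrow> real^3) \<in> borel_measurable borel"
  unfolding sgn_div_norm[abs_def] by measurable

lemma emeasure_ball3_pos: "emeasure lborel (ball 0 1 :: (real^3) set) \<noteq> 0"
  using open_not_negligible[of "ball 0 1 :: (real^3) set"]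
  by (simp add: negligible_iff_emeasure0)

lemma emeasure_ball3_fin: "emeasure lborel (ball 0 1 :: (real^3) set) \<noteq> \<infinity>"
  using emeasure_bounded_finite[of "ball 0 1 :: (real^3) set"] by (simp add: less_top)

lemma sets_uniform_sphere: "sets uniform_sphere = sets borel"
  by (simp add: uniform_sphere_def)

lemma space_uniform_sphere: "space uniform_sphere = UNIV"
  by (simp add: uniform_sphere_def)

lemma prob_space_uniform_sphere: "prob_space uniform_sphere"
  unfolding uniform_sphere_def
  by (intro prob_space.prob_space_distr prob_space_uniform_measure)
     (use emeasure_ball3_pos emeasure_ball3_fin sgn_borel_measurable in auto)

lemma emeasure_uniform_sphere:
  assumes "A \<in> sets borel"
  shows "emeasure uniform_sphere A
    = emeasure lborel (ball 0 1 \<inter> sgn -` A) / emeasure lborel (ball 0 1 :: (real^3) set)"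
proof -
  have "sgn -` A \<in> sets (borel :: (real^3) measure)"
    using measurable_sets[OF sgn_borel_measurable assms] by simp
  then show ?thesis
    unfolding uniform_sphere_def using assms sgn_borel_measurable
    by (simp add: emeasure_distr)
qed

lemma emeasure_uniform_sphere_sphere: "emeasure uniform_sphere (sphere 0 1) = 1"
proof -
  have "ball 0 1 \<inter> sgn -` sphere 0 1 = ball 0 1 - {0 :: real^3}"
    by (auto simp: norm_sgn)
  moreover have "emeasure lborel (ball 0 1 - {0 :: real^3}) = emeasure lborel (ball 0 1 :: (real^3) set)"
    by (subst emeasure_Diff) auto
  ultimately show ?thesis
    using emeasure_ball3_pos emeasure_ball3_fin by (simp add: emeasure_uniform_sphere ennreal_divide_self less_top)
qed

lemma uniform_sphere_orthogonal_invariant: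
  fixes f :: "real^3 \<Rightarrow> real^3"
  assumes f: "orthogonal_transformation f"
  shows "distr uniform_sphere borel f = uniform_sphere"
proof (rule measure_eqI)
  show "sets (distr uniform_sphere borel f) = sets uniform_sphere"
    by (simp add: sets_uniform_sphere)
  have lin: "linear f" and nf: "\<And>x. norm (f x) = norm x" and bij: "bij f"
    using f by (auto simp: orthogonal_transformation_linear orthogonal_transformation_norm
        orthogonal_transformation_bij)
  have fm: "f \<in> borel_measurable borel"
    by (intro borel_measurable_continuous_onI linear_continuous_on linear_conv_bounded_linear[THEN iffD1] lin)
  have fm': "f \<in> measurable uniform_sphere borel"
    using fm by (simp add: measurable_cong_sets[OF sets_uniform_sphere refl])
  have sf: "sgn (f x) = f (sgn x)" for x
    using lin by (simp add: sgn_div_norm nf linear_cmul)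
  fix A assume "A \<in> sets (distr uniform_sphere borel f)"
  then have A: "A \<in> sets borel" by simp
  have fA: "f -` A \<in> sets borel"
    using measurable_sets[OF fm A] by simp
  define B where "B = ball 0 1 \<inter> sgn -` f -` A"
  have sfA: "sgn -` f -` A \<in> sets (borel :: (real^3) measure)" "sgn -` A \<in> sets (borel :: (real^3) measure)"
    using measurable_sets[OF sgn_borel_measurable fA] measurable_sets[OF sgn_borel_measurable A]
    by simp_all
  have B: "B \<in> sets borel" unfolding B_def using sfA by auto
  have "f ` B = ball 0 1 \<inter> sgn -` A"
  proof (rule set_eqI)
    fix y
    obtain x where y: "y = f x" using bij by (meson bij_pointE)
    show "y \<in> f ` B \<longleftrightarrow> y \<in> ball 0 1 \<inter> sgn -` A"
      using bij by (simp add: y B_def inj_image_mem_iff bij_is_inj nf sf)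
  qed
  moreover have Bl: "B \<in> lmeasurable"
    using B by (intro bounded_set_imp_lmeasurable) (auto simp: B_def bounded_Int)
  ultimately have fB: "f ` B \<in> sets borel" and
    feq: "f ` B = ball 0 1 \<inter> sgn -` A" using sfA by auto
  have "emeasure lebesgue (f ` B) = emeasure lebesgue B"
    using measure_orthogonal_image[OF f Bl] measurable_orthogonal_image[OF f Bl] Bl
    by (simp add: emeasure_eq_measure2)
  then have "emeasure lborel (ball 0 1 \<inter> sgn -` A) = emeasure lborel B"
    using B fB by (simp add: feq)
  then show "emeasure (distr uniform_sphere borel f) A = emeasure uniform_sphere A"
    using A fA fm' by (simp add: emeasure_distr emeasure_uniform_sphere B_def
        sets_uniform_sphere space_uniform_sphere)
qed

definition I3 :: "real^3 \<Rightarrow> real^3 \<Rightarrow> real^3 \<Rightarrow> real" where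
  "I3 n1 n2 n3 = (\<integral>u. \<bar>u \<bullet> n1\<bar> * \<bar>u \<bullet> n2\<bar> * \<bar>u \<bullet> n3\<bar> \<partial>uniform_sphere)"

definition gram :: "real^3 \<Rightarrow> real^3 \<Rightarrow> real^3 \<Rightarrow> real^3^3" where
  "gram n1 n2 n3 = (let n = vector [n1, n2, n3] :: (real^3)^3 in \<chi> i j. (n $ i) \<bullet> (n $ j))"

definition pos_semidef :: "real^'n^'n \<Rightarrow> bool" where
  "pos_semidef A \<longleftrightarrow> transpose A = A \<and> (\<forall>v. 0 \<le> v \<bullet> (A *v v))"

text \<open>In the following, the sign $\pm$ of a class is a real parameter \<open>s\<close>, used only with
  the values \<open>1\<close> and \<open>- 1\<close>.\<close>

definition G :: "real \<Rightarrow> real \<Rightarrow> real \<Rightarrow> real \<Rightarrow> real^3^3" where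
  "G s a b c = vector [vector [1, a, b], vector [a, 1, s * c], vector [b, s * c, 1]]"

definition Delta :: "real \<Rightarrow> real \<Rightarrow> real \<Rightarrow> real \<Rightarrow> real" where
  "Delta s a b c = 1 - a\<^sup>2 - b\<^sup>2 - c\<^sup>2 + s * (2 * a * b * c)"

definition feasible :: "real \<Rightarrow> real \<Rightarrow> real \<Rightarrow> real \<Rightarrow> bool" where
  "feasible s a b c \<longleftrightarrow> pos_semidef (G s a b c)"

text \<open>The common value of \<^const>\<open>I3\<close> on all unit triples with the given Gram matrix; meaningful
  when the class is feasible.\<close>

definition J :: "real \<Rightarrow> real \<Rightarrow> real \<Rightarrow> real \<Rightarrow> real" where
  "J s a b c = (THE v. \<exists>n1\<in>sphere 0 1. \<exists>n2\<in>sphere 0 1. \<exists>n3\<in>sphere 0 1.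
     gram n1 n2 n3 = G s a b c \<and> v = I3 n1 n2 n3)"

text \<open>When $\Delta_- = 0$ this is unbounded on $[0,a]\times[0,b]\times[-c,c]$, near the corner
  $(a,b,-c)$ only.  Being nonnegative, it has an improper integral exactly if it is Lebesgue
  integrable there, and the two integrals then agree.\<close>

definition J_integrand :: "real \<Rightarrow> real \<Rightarrow> real \<Rightarrow> real" where
  "J_integrand x y z = 1 / sqrt (1 - x\<^sup>2 - y\<^sup>2 - z\<^sup>2 + 2 * x * y * z)"

end

(*
  Write |y| = (1/pi) int (1 - cos (t y)) / t^2 dt for each of the three factors and average over a
  Gaussian vector instead of the sphere (the two differ by the constant 32 pi, by homogeneity).
  All integrands are nonnegative, so Tonelli gives I3 as an integral over t of a kernel in which
  the triangle sign enters only through the term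
    exp (-|t|^2 / 2) sinh (a t1 t2) sinh (b t1 t3) sinh (c t2 t3) / (t1 t2 t3)^2.
  Since 2 sinh (a u) / u is the integral of exp (- x u) over x in [-a, a], a second use of Tonelli
  turns this term into the integral over a box of Gaussian integrals in t, each of which is a
  multiple of 1 / sqrt (det G).  No differentiation in the correlations is needed, the degenerate
  case Delta_- = 0 requires no limit, and integrability comes for free because I3 is finite.
  The lower bound holds because det G <= 1.
*)

theory Submission
  imports Defs "HOL-Real_Asymp.Real_Asymp"
begin

section \<open>Gaussian integrals and the Fourier representation of the absolute value\<close>

text \<open>For a Gaussian vector the mean of a cosine of a linear form is the exponential of a
  quadratic form, so the correlations enter the kernel only through hyperbolic functions of
  \<open>a * t1 * t2\<close>, \<open>b * t1 * t3\<close>, \<open>c * t2 * t3\<close>. Each cosh is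
  even, hence the sinh product is the only term that sees the triangle sign. The second Tonelli step
  yields the box \<open>{-a..a} \<times> {-b..b} \<times> {-c..c}\<close>. The determinant is
  unchanged when two of \<open>x\<close>, \<open>y\<close>, \<open>z\<close> change sign, which
  folds this box four to one onto the domain of the theorem. The condition
  \<open>Delta (- 1) a b c \<ge> 0\<close> acts here: it bounds the determinant from below on the
  box, so the Gaussian integrals converge off a null set. Constants: let
  \<open>K = sqrt (2 * pi) ^ 3\<close>. The sinh term carries \<open>2 * K\<close>, the three
  representations of sinh give \<open>1 / 8\<close>, folding gives 4 and the Gaussian integral
  another \<open>K\<close>. So \<open>32 * pi ^ 4\<close> times the difference is
  \<open>K * K = 8 * pi ^ 3\<close> times the box integral, which is where
  \<open>1 / (4 * pi)\<close> comes from. The comparison is kept additive in \<open>ennreal\<close>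
  until finiteness is known.\<close>

lemma gaussian_iexp_integral:
  fixes s :: real
  defines "f \<equiv> \<lambda>y. exp (- y\<^sup>2 / 2) *\<^sub>R iexp (s * y)"
  shows "has_bochner_integral lborel f (complex_of_real (sqrt (2 * pi) * exp (- s\<^sup>2 / 2)))"
proof -
  have f: "f = (\<lambda>y. sqrt (2 * pi) *\<^sub>R (std_normal_density y *\<^sub>R iexp (s * y)))"
    by (auto simp: f_def std_normal_density_def)
  have int: "integrable lborel (\<lambda>y. std_normal_density y *\<^sub>R iexp (s * y))"
  proof (rule Bochner_Integration.integrable_bound)
    show "integrable lborel std_normal_density" by simp
  qed auto
  have "(\<integral>y. std_normal_density y *\<^sub>R iexp (s * y) \<partial>lborel) = char std_normal_distribution s"
    unfolding char_def by (subst integral_density) auto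
  also have "\<dots> = complex_of_real (exp (- s\<^sup>2 / 2))"
    by (simp add: char_std_normal_distribution)
  finally show ?thesis
    unfolding f has_bochner_integral_iff using int by (auto simp: scaleR_conv_of_real)
qed

text \<open>A complex exponential of \<open>x \<bullet> v\<close> factors over the coordinates, a
  cosine does not. So the characteristic function is computed coordinatewise and the real part is
  taken at the end.\<close>

lemma gaussian_cos_integral:
  fixes v :: "'a :: euclidean_space"
  shows "has_bochner_integral lborel (\<lambda>x. cos (x \<bullet> v) * exp (- (norm x)\<^sup>2 / 2))
    (sqrt (2 * pi) ^ DIM('a) * exp (- (norm v)\<^sup>2 / 2))"
proof -
  interpret product_sigma_finite "\<lambda>_::'a. lborel :: real measure" ..
  define f where "f = (\<lambda>b y. exp (- y\<^sup>2 / 2) *\<^sub>R iexp ((v \<bullet> b) * y))"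
  have f: "has_bochner_integral lborel (f b)
      (complex_of_real (sqrt (2 * pi) * exp (- (v \<bullet> b)\<^sup>2 / 2)))" for b
    unfolding f_def by (rule gaussian_iexp_integral)
  have fm[measurable]: "f b \<in> borel_measurable borel" for b
    using borel_measurable_has_bochner_integral[OF f[of b]] by simp
  have sq: "(norm x)\<^sup>2 = (\<Sum>b\<in>Basis. (x \<bullet> b)\<^sup>2)" for x :: 'a
    by (subst power2_norm_eq_inner, subst euclidean_inner) (simp add: power2_eq_square)
  have ff: "(\<Prod>b\<in>Basis. f b (x \<bullet> b)) = exp (- (norm x)\<^sup>2 / 2) *\<^sub>R iexp (x \<bullet> v)" for x
  proof -
    have "(\<Prod>b\<in>Basis. f b (x \<bullet> b))
        = (\<Prod>b\<in>Basis. exp (- (x \<bullet> b)\<^sup>2 / 2)) *\<^sub>R (\<Prod>b\<in>Basis. iexp ((v \<bullet> b) * (x \<bullet> b)))"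
      by (simp add: f_def scaleR_conv_of_real prod.distrib)
    also have "(\<Prod>b\<in>Basis. exp (- (x \<bullet> b)\<^sup>2 / 2)) = exp (- (norm x)\<^sup>2 / 2)"
      by (simp add: exp_sum[symmetric] sq sum_negf sum_divide_distrib)
    also have "(\<Prod>b\<in>Basis. iexp ((v \<bullet> b) * (x \<bullet> b))) = iexp (x \<bullet> v)"
      by (subst euclidean_inner[of x v])
         (simp add: exp_sum[symmetric] sum_distrib_left mult_ac)
    finally show ?thesis .
  qed
  have "integrable lborel (\<lambda>x. \<Prod>b\<in>Basis. f b (x \<bullet> b))"
    using f
    by (subst lborel_eq, subst integrable_distr_eq) (auto intro!: product_integrable_prod simp: has_bochner_integral_iff)
  moreover have "(\<integral>x. (\<Prod>b\<in>Basis. f b (x \<bullet> b)) \<partial>lborel) = (\<Prod>b\<in>Basis. integral\<^sup>L lborel (f b))"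
    by (subst (1) lborel_eq, subst integral_distr)
       (auto simp: product_integral_prod[OF finite_Basis integrable.intros[OF f]])
  moreover have "(\<Prod>b\<in>Basis. integral\<^sup>L lborel (f b))
      = complex_of_real (\<Prod>b\<in>Basis. sqrt (2 * pi) * exp (- (v \<bullet> b)\<^sup>2 / 2))"
    unfolding of_real_prod using f by (intro prod.cong) (auto simp: has_bochner_integral_iff)
  moreover have "(\<Prod>b\<in>Basis. sqrt (2 * pi) * exp (- (v \<bullet> b)\<^sup>2 / 2))
      = sqrt (2 * pi) ^ DIM('a) * exp (- (norm v)\<^sup>2 / 2)"
    by (simp add: prod.distrib exp_sum[symmetric] sq sum_negf sum_divide_distrib)
  ultimately have "has_bochner_integral lborel (\<lambda>x. exp (- (norm x)\<^sup>2 / 2) *\<^sub>R iexp (x \<bullet> v))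
      (complex_of_real (sqrt (2 * pi) ^ DIM('a) * exp (- (norm v)\<^sup>2 / 2)))"
    by (simp only: ff has_bochner_integral_iff simp_thms)
  from has_bochner_integral_bounded_linear[OF bounded_linear_Re this]
  show ?thesis by (simp add: cis_conv_exp[symmetric] mult.commute)
qed

lemma nn_integral_gaussian:
  fixes m s :: real
  assumes s: "s > 0"
  shows "(\<integral>\<^sup>+t. ennreal (exp (- (s * (t - m)\<^sup>2) / 2)) \<partial>lborel) = ennreal (sqrt (2 * pi / s))"
proof -
  have "(\<integral>\<^sup>+t. ennreal (exp (- (s * (t - m)\<^sup>2) / 2)) \<partial>lborel)
      = (\<integral>\<^sup>+t. ennreal (sqrt (2 * pi / s)) * ennreal (normal_density m (1 / sqrt s) t) \<partial>lborel)"
    using s by (intro nn_integral_cong)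
      (simp add: normal_density_def ennreal_mult[symmetric] real_sqrt_mult[symmetric]
        power_divide real_sqrt_divide mult.commute)
  also have "\<dots> = ennreal (sqrt (2 * pi / s)) * (\<integral>\<^sup>+t. ennreal (normal_density m (1 / sqrt s) t) \<partial>lborel)"
    by (rule nn_integral_cmult) simp
  also have "(\<integral>\<^sup>+t. ennreal (normal_density m (1 / sqrt s) t) \<partial>lborel) = 1"
    using s by (subst nn_integral_eq_integral) auto
  finally show ?thesis by simp
qed

text \<open>Substituting \<open>x * t\<close> for \<open>t\<close> pulls out
  \<open>\<bar>x\<bar>\<close> and leaves a constant that may still be infinite at this stage; for
  \<open>x = 0\<close> the convention \<open>0 * \<infinity> = 0\<close> applies.\<close>

lemma nn_integral_one_minus_cos_scale:
  fixes x :: real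
  defines "C \<equiv> (\<integral>\<^sup>+t. ennreal ((1 - cos t) / t\<^sup>2) \<partial>lborel)"
  shows "(\<integral>\<^sup>+t. ennreal ((1 - cos (t * x)) / t\<^sup>2) \<partial>lborel) = ennreal \<bar>x\<bar> * C"
proof (cases "x = 0")
  case False
  have "ennreal \<bar>x\<bar> * C = ennreal \<bar>x\<bar> * (ennreal \<bar>x\<bar> * (\<integral>\<^sup>+t. ennreal ((1 - cos (x * t)) / (x * t)\<^sup>2) \<partial>lborel))"
    unfolding C_def using nn_integral_real_affine[OF _ False, of "\<lambda>t. ennreal ((1 - cos t) / t\<^sup>2)" 0] by simp
  also have "\<dots> = ennreal (x\<^sup>2) * (\<integral>\<^sup>+t. ennreal ((1 - cos (x * t)) / (x * t)\<^sup>2) \<partial>lborel)"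
    by (simp add: mult.assoc[symmetric] ennreal_mult[symmetric] power2_eq_square)
  also have "\<dots> = (\<integral>\<^sup>+t. ennreal (x\<^sup>2) * ennreal ((1 - cos (x * t)) / (x * t)\<^sup>2) \<partial>lborel)"
    by (rule nn_integral_cmult[symmetric]) simp
  also have "\<dots> = (\<integral>\<^sup>+t. ennreal ((1 - cos (t * x)) / t\<^sup>2) \<partial>lborel)"
    using False by (intro nn_integral_cong)
      (simp add: ennreal_mult[symmetric] power_mult_distrib mult.commute)
  finally show ?thesis by simp
qed simp

text \<open>The integrand is the integral of \<open>r * exp (- (r * t)\<^sup>2 / 2)\<close> over
  \<open>r\<close> in \<open>{0..1}\<close>. After Tonelli the Gaussian integral in \<open>t\<close>
  is \<open>sqrt (2 * pi) / r\<close>, and the factor \<open>r\<close> cancels.\<close>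

lemma nn_integral_one_minus_exp:
  "(\<integral>\<^sup>+t. ennreal ((1 - exp (- t\<^sup>2 / 2)) / t\<^sup>2) \<partial>lborel) = ennreal (sqrt (2 * pi))"
proof -
  have "(\<integral>\<^sup>+t. ennreal ((1 - exp (- t\<^sup>2 / 2)) / t\<^sup>2) \<partial>lborel)
      = (\<integral>\<^sup>+t. \<integral>\<^sup>+r. ennreal (r * exp (- (r * t)\<^sup>2 / 2)) * indicator {0..1} r \<partial>lborel \<partial>lborel)"
  proof (rule nn_integral_cong_AE, rule AE_mp[OF AE_lborel_singleton[of 0] AE_I2], intro impI)
    fix t :: real assume t: "t \<noteq> 0"
    have "(\<integral>\<^sup>+r. ennreal (r * exp (- (r * t)\<^sup>2 / 2)) * indicator {0..1} r \<partial>lborel)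
        = ennreal (- exp (- (1 * t)\<^sup>2 / 2) / t\<^sup>2 - (- exp (- (0 * t)\<^sup>2 / 2) / t\<^sup>2))"
      using t by (intro nn_integral_FTC_Icc)
        (auto intro!: derivative_eq_intros simp: power2_eq_square)
    then show "ennreal ((1 - exp (- t\<^sup>2 / 2)) / t\<^sup>2)
        = (\<integral>\<^sup>+r. ennreal (r * exp (- (r * t)\<^sup>2 / 2)) * indicator {0..1} r \<partial>lborel)"
      by (simp add: diff_divide_distrib)
  qed
  also have "\<dots> = (\<integral>\<^sup>+r. \<integral>\<^sup>+t. ennreal (r * exp (- (r * t)\<^sup>2 / 2)) * indicator {0..1} r \<partial>lborel \<partial>lborel)"
    by (rule lborel_pair.Fubini') measurable
  also have "\<dots> = (\<integral>\<^sup>+r. ennreal (sqrt (2 * pi)) * indicator {0..1::real} r \<partial>lborel)"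
  proof (rule nn_integral_cong_AE, rule AE_mp[OF AE_lborel_singleton[of 0] AE_I2], intro impI)
    fix r :: real assume r: "r \<noteq> 0"
    show "(\<integral>\<^sup>+t. ennreal (r * exp (- (r * t)\<^sup>2 / 2)) * indicator {0..1} r \<partial>lborel)
        = ennreal (sqrt (2 * pi)) * indicator {0..1} r"
    proof (cases "r \<in> {0..1}")
      case True
      then have "(\<integral>\<^sup>+t. ennreal (r * exp (- (r * t)\<^sup>2 / 2)) * indicator {0..1} r \<partial>lborel)
          = ennreal r * (\<integral>\<^sup>+t. ennreal (exp (- (r\<^sup>2 * (t - 0)\<^sup>2) / 2)) \<partial>lborel)"
        by (subst nn_integral_cmult[symmetric])
           (auto simp: ennreal_mult[symmetric] power_mult_distrib intro!: nn_integral_cong)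
      also have "\<dots> = ennreal (sqrt (2 * pi))"
        using r True by (subst nn_integral_gaussian) (auto simp: ennreal_mult[symmetric] real_sqrt_divide)
      finally show ?thesis using True by simp
    qed simp
  qed
  also have "\<dots> = ennreal (sqrt (2 * pi))"
    by (subst nn_integral_cmult) auto
  finally show ?thesis .
qed

text \<open>The constant \<open>\<pi>\<close> comes from averaging the scaled identity over a standard normal variable.\<close>

lemma nn_integral_one_minus_cos:
  fixes x :: real
  shows "(\<integral>\<^sup>+t. ennreal ((1 - cos (t * x)) / t\<^sup>2) \<partial>lborel) = ennreal (pi * \<bar>x\<bar>)"
proof -
  define C where "C = (\<integral>\<^sup>+t. ennreal ((1 - cos t) / t\<^sup>2) \<partial>lborel)"
  define g :: "real \<Rightarrow> real" where "g = (\<lambda>x. exp (- x\<^sup>2 / 2))"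
  have g[measurable]: "g \<in> borel_measurable borel" and g0: "g x \<ge> 0" for x by (auto simp: g_def)
  have "(\<integral>\<^sup>+x. ennreal (std_normal_density x * \<bar>x\<bar>) \<partial>lborel) = ennreal (sqrt (2 / pi))"
    using std_normal_moment_abs_odd[of 0]
    by (subst nn_integral_eq_integral) (auto simp: has_bochner_integral_iff)
  then have "(\<integral>\<^sup>+x. ennreal (sqrt (2 * pi)) * ennreal (std_normal_density x * \<bar>x\<bar>) \<partial>lborel)
      = ennreal (sqrt (2 * pi)) * ennreal (sqrt (2 / pi))"
    by (subst nn_integral_cmult) auto
  also have "\<dots> = 2"
    by (simp add: ennreal_mult[symmetric] real_sqrt_mult[symmetric])
  finally have two: "(\<integral>\<^sup>+x. ennreal (g x * \<bar>x\<bar>) \<partial>lborel) = 2"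
    by (simp add: g_def ennreal_mult[symmetric] std_normal_density_def)
  \<comment> \<open>The same double integral is evaluated twice: integrating over \<open>t\<close>
    first gives \<open>2 * C\<close>, over \<open>x\<close> first gives
    \<open>sqrt (2 * pi) * sqrt (2 * pi)\<close>.\<close>
  have "2 * C = (\<integral>\<^sup>+x. ennreal (g x * \<bar>x\<bar>) * C \<partial>lborel)"
    using two by (subst nn_integral_multc) auto
  also have "\<dots> = (\<integral>\<^sup>+x. \<integral>\<^sup>+t. ennreal (g x) * ennreal ((1 - cos (t * x)) / t\<^sup>2) \<partial>lborel \<partial>lborel)"
    by (simp add: nn_integral_cmult nn_integral_one_minus_cos_scale C_def ennreal_mult g0 mult.assoc)
  also have "\<dots> = (\<integral>\<^sup>+t. \<integral>\<^sup>+x. ennreal (g x) * ennreal ((1 - cos (t * x)) / t\<^sup>2) \<partial>lborel \<partial>lborel)"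
    by (rule lborel_pair.Fubini') measurable
  also have "\<dots> = (\<integral>\<^sup>+t. ennreal (sqrt (2 * pi)) * ennreal ((1 - exp (- t\<^sup>2 / 2)) / t\<^sup>2) \<partial>lborel)"
  proof (rule nn_integral_cong)
    fix t :: real
    \<comment> \<open>The constant 1 is treated as the cosine with frequency 0, so one formula
      serves both terms.\<close>
    have "has_bochner_integral lborel (\<lambda>x. (cos (x \<bullet> 0) * g (norm x) - cos (x \<bullet> t) * g (norm x)) / t\<^sup>2)
       ((sqrt (2 * pi) ^ DIM(real) * g (norm (0::real)) - sqrt (2 * pi) ^ DIM(real) * g (norm t)) / t\<^sup>2)"
      unfolding g_def by (intro has_bochner_integral_divide_zero has_bochner_integral_diff gaussian_cos_integral)
    then have "has_bochner_integral lborel (\<lambda>x. g x * ((1 - cos (t * x)) / t\<^sup>2))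
       (sqrt (2 * pi) * ((1 - g t) / t\<^sup>2))"
      by (simp add: g_def field_simps)
    then show "(\<integral>\<^sup>+x. ennreal (g x) * ennreal ((1 - cos (t * x)) / t\<^sup>2) \<partial>lborel)
        = ennreal (sqrt (2 * pi)) * ennreal ((1 - exp (- t\<^sup>2 / 2)) / t\<^sup>2)"
      by (simp add: ennreal_mult[symmetric] g0 g_def has_bochner_integral_iff nn_integral_eq_integral)
  qed
  also have "\<dots> = ennreal (2 * pi)"
    by (subst nn_integral_cmult, simp, subst nn_integral_one_minus_exp)
       (simp add: ennreal_mult[symmetric])
  also have "ennreal (2 * pi) = 2 * ennreal pi"
    by (subst ennreal_mult) auto
  finally have "C = ennreal pi"
    by (subst (asm) ennreal_mult_cancel_left) auto
  then show ?thesis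
    using nn_integral_one_minus_cos_scale[of x]
    by (simp only: C_def ennreal_mult'[OF pi_ge_zero] mult.commute)
qed

section \<open>From the sphere to Gaussian space\<close>

lemma nn_integral_greaterThan:
  fixes a :: real
  shows "(\<integral>\<^sup>+r. k r * indicator {a<..} r \<partial>lborel) = (\<integral>\<^sup>+r. k r * indicator {a..} r \<partial>lborel)"
  by (intro nn_integral_cong_AE AE_mp[OF AE_lborel_singleton[of a] AE_I2])
     (auto split: split_indicator)

lemma nn_integral_scaleR:
  fixes f :: "'a :: euclidean_space \<Rightarrow> ennreal"
  assumes [measurable]: "f \<in> borel_measurable borel" and c: "c \<noteq> 0"
  shows "(\<integral>\<^sup>+x. f x \<partial>lborel) = ennreal (\<bar>c\<bar> ^ DIM('a)) * (\<integral>\<^sup>+x. f (c *\<^sub>R x) \<partial>lborel)"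
  by (subst lborel_affine[OF c, of 0])
     (simp add: nn_integral_density nn_integral_distr nn_integral_cmult)

text \<open>A substitute for polar coordinates. Tonelli turns the radial weight into integrals of
  \<open>\<Phi>\<close> over balls of radius \<open>r\<close>, and scaling to the unit ball gives
  \<open>r ^ DIM('a)\<close> from the volume and \<open>r ^ d\<close> from homogeneity.\<close>

lemma homogeneous_layer_cake:
  fixes \<Phi> :: "'a :: euclidean_space \<Rightarrow> ennreal" and k :: "real \<Rightarrow> ennreal"
  assumes [measurable]: "\<Phi> \<in> borel_measurable borel" "k \<in> borel_measurable borel"
  assumes hom: "\<And>r x. r > 0 \<Longrightarrow> \<Phi> (r *\<^sub>R x) = ennreal (r ^ d) * \<Phi> x"
  shows "(\<integral>\<^sup>+x. \<Phi> x * (\<integral>\<^sup>+r. k r * indicator {norm x<..} r \<partial>lborel) \<partial>lborel)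
    = (\<integral>\<^sup>+x. \<Phi> x * indicator (ball 0 1) x \<partial>lborel)
      * (\<integral>\<^sup>+r. k r * ennreal (r ^ (DIM('a) + d)) * indicator {0<..} r \<partial>lborel)" (is "?L = ?M * ?R")
proof -
  have [simp]: "(\<lambda>x. \<Phi> x * indicator (ball 0 r) x) \<in> borel_measurable borel" for r
    by (intro borel_measurable_times_ennreal borel_measurable_indicator) auto
  have scale: "(\<integral>\<^sup>+x. \<Phi> x * indicator (ball 0 r) x \<partial>lborel) = ennreal (r ^ (DIM('a) + d)) * ?M"
    if r: "r > 0" for r
  proof -
    have *: "indicator (ball 0 r) (r *\<^sub>R x) = (indicator (ball 0 1) x :: ennreal)" for x :: 'a
      using r by (auto split: split_indicator)
    have "(\<integral>\<^sup>+x. \<Phi> x * indicator (ball 0 r) x \<partial>lborel)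
        = ennreal (r ^ DIM('a)) * (\<integral>\<^sup>+x. ennreal (r ^ d) * (\<Phi> x * indicator (ball 0 1) x) \<partial>lborel)"
      using r by (subst nn_integral_scaleR[of _ r]) (measurable, simp_all add: hom * mult.assoc)
    also have "\<dots> = ennreal (r ^ (DIM('a) + d)) * ?M"
      using r by (subst nn_integral_cmult) (simp_all add: power_add ennreal_mult mult.assoc)
    finally show ?thesis .
  qed
  have "?L = (\<integral>\<^sup>+x. \<integral>\<^sup>+r. \<Phi> x * (k r * indicator {norm x<..} r) \<partial>lborel \<partial>lborel)"
    by (intro nn_integral_cong nn_integral_cmult[symmetric]) simp
  \<comment> \<open>The set \<open>{norm x<..}\<close> varies with \<open>x\<close>; unfolding its
    indicator to the condition \<open>norm x < r\<close> makes joint measurability visible.\<close>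
  also have "\<dots> = (\<integral>\<^sup>+r. \<integral>\<^sup>+x. \<Phi> x * (k r * indicator {norm x<..} r) \<partial>lborel \<partial>lborel)"
    unfolding greaterThan_def indicator_def by (rule lborel_pair.Fubini'[symmetric]) simp
  also have "\<dots> = (\<integral>\<^sup>+r. ?M * (k r * ennreal (r ^ (DIM('a) + d)) * indicator {0<..} r) \<partial>lborel)"
  proof (rule nn_integral_cong)
    fix r :: real
    have "(\<integral>\<^sup>+x. \<Phi> x * (k r * indicator {norm x<..} r) \<partial>lborel)
        = (\<integral>\<^sup>+x. k r * (\<Phi> x * indicator (ball 0 r) x) \<partial>lborel)"
      by (intro nn_integral_cong) (auto split: split_indicator simp: mult_ac)
    also have "\<dots> = k r * (\<integral>\<^sup>+x. \<Phi> x * indicator (ball 0 r) x \<partial>lborel)"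
      by (rule nn_integral_cmult) simp
    also have "\<dots> = ?M * (k r * ennreal (r ^ (DIM('a) + d)) * indicator {0<..} r)"
      by (cases "r > 0") (simp_all add: scale[of r] ball_empty not_less mult_ac)
    finally show "(\<integral>\<^sup>+x. \<Phi> x * (k r * indicator {norm x<..} r) \<partial>lborel)
        = ?M * (k r * ennreal (r ^ (DIM('a) + d)) * indicator {0<..} r)" .
  qed
  also have "\<dots> = ?M * ?R" by (rule nn_integral_cmult) simp
  finally show ?thesis .
qed

text \<open>Both \<open>exp (- |x|\<^sup>2 / 2)\<close> and \<open>1 / |x|\<^sup>3 - 1\<close> (the latter on the unit ball) are integrals over
  \<open>r > |x|\<close>, so for a function of degree 3 both sides are multiples of its integral over the ball.\<close>

lemma nn_integral_uniform_sphere: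
  fixes \<Phi> :: "real^3 \<Rightarrow> ennreal"
  assumes [measurable]: "\<Phi> \<in> borel_measurable borel"
  assumes hom: "\<And>r x. r > 0 \<Longrightarrow> \<Phi> (r *\<^sub>R x) = ennreal (r ^ 3) * \<Phi> x"
  shows "(\<integral>\<^sup>+u. \<Phi> u \<partial>uniform_sphere)
    = (\<integral>\<^sup>+x. \<Phi> x * ennreal (exp (- (norm x)\<^sup>2 / 2)) \<partial>lborel) / ennreal (32 * pi)"
proof -
  note [measurable] = sgn_borel_measurable
  define M where "M = (\<integral>\<^sup>+x. \<Phi> x * indicator (ball 0 1) x \<partial>lborel)"
  \<comment> \<open>Negative derivatives of \<open>exp (- r\<^sup>2 / 2)\<close> and, cut off at 1,
    of \<open>1 / r ^ 3\<close>.\<close>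
  define k1 :: "real \<Rightarrow> ennreal" where "k1 = (\<lambda>r. ennreal (r * exp (- r\<^sup>2 / 2)))"
  define k2 :: "real \<Rightarrow> ennreal" where "k2 = (\<lambda>r. ennreal (3 / r ^ 4) * indicator {0<..1} r)"
  have [measurable]: "k1 \<in> borel_measurable borel" "k2 \<in> borel_measurable borel"
    by (simp_all add: k1_def k2_def)
  have k1: "(\<integral>\<^sup>+r. k1 r * indicator {a<..} r \<partial>lborel) = ennreal (exp (- a\<^sup>2 / 2))" if "a \<ge> 0" for a
  proof -
    have "(\<integral>\<^sup>+r. k1 r * indicator {a..} r \<partial>lborel) = ennreal (0 - (- exp (- a\<^sup>2 / 2)))"
      unfolding k1_def
    proof (rule nn_integral_FTC_atLeast)
      show "((\<lambda>r::real. - exp (- r\<^sup>2 / 2)) \<longlongrightarrow> 0) at_top" by real_asymp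
    qed (use that in \<open>auto intro!: derivative_eq_intros\<close>)
    then show ?thesis by (simp add: nn_integral_greaterThan)
  qed
  have k1': "(\<integral>\<^sup>+r. k1 r * ennreal (r ^ 6) * indicator {0<..} r \<partial>lborel) = 48"
  proof -
    \<comment> \<open>The exponent 7 is 1 from \<open>k1\<close> plus dimension 3 plus degree 3.
      Repeated integration by parts against \<open>r * exp (- r\<^sup>2 / 2)\<close> produces the
      coefficients 1, 6, \<open>6 * 4\<close>, \<open>6 * 4 * 2\<close>.\<close>
    define F where "F = (\<lambda>r::real. - (r ^ 6 + 6 * r ^ 4 + 24 * r\<^sup>2 + 48) * exp (- r\<^sup>2 / 2))"
    have "(\<integral>\<^sup>+r. ennreal (r ^ 7 * exp (- r\<^sup>2 / 2)) * indicator {0..} r \<partial>lborel) = ennreal (0 - F 0)"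
    proof (rule nn_integral_FTC_atLeast)
      show "(F \<longlongrightarrow> 0) at_top" unfolding F_def by real_asymp
      show "DERIV F r :> r ^ 7 * exp (- r\<^sup>2 / 2)" for r
        unfolding F_def by (auto intro!: derivative_eq_intros simp: field_simps power_numeral_reduce)
    qed auto
    moreover have "(\<integral>\<^sup>+r. k1 r * ennreal (r ^ 6) * indicator {0..} r \<partial>lborel)
        = (\<integral>\<^sup>+r. ennreal (r ^ 7 * exp (- r\<^sup>2 / 2)) * indicator {0..} r \<partial>lborel)"
      by (intro nn_integral_cong)
         (auto split: split_indicator simp: k1_def ennreal_mult[symmetric] power_numeral_reduce mult_ac)
    ultimately show ?thesis by (simp add: nn_integral_greaterThan F_def)
  qed
  have k2: "(\<integral>\<^sup>+r. k2 r * indicator {a<..} r \<partial>lborel) = ennreal (1 / a ^ 3 - 1)" if a: "0 < a" "a < 1" for a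
  proof -
    have "(\<integral>\<^sup>+r. ennreal (3 / r ^ 4) * indicator {a..1} r \<partial>lborel) = ennreal (- 1 / 1 ^ 3 - (- 1 / a ^ 3))"
    proof (rule nn_integral_FTC_Icc[where F = "\<lambda>r. - 1 / r ^ 3"])
      show "((\<lambda>r. - 1 / r ^ 3) has_real_derivative 3 / r ^ 4) (at r)" if "r \<in> {a..1}" for r
        using a that by (auto intro!: derivative_eq_intros simp: field_simps power_numeral_reduce)
    qed (use a in auto)
    moreover have "(\<integral>\<^sup>+r. k2 r * indicator {a..} r \<partial>lborel)
        = (\<integral>\<^sup>+r. ennreal (3 / r ^ 4) * indicator {a..1} r \<partial>lborel)"
      using a by (intro nn_integral_cong) (auto split: split_indicator simp: k2_def)
    ultimately show ?thesis by (simp add: nn_integral_greaterThan)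
  qed
  have k2_0: "(\<integral>\<^sup>+r. k2 r * indicator {a<..} r \<partial>lborel) = 0" if "a \<ge> 1" for a
  proof -
    have "(\<lambda>r. k2 r * indicator {a<..} r) = (\<lambda>_. 0)"
      using that by (auto split: split_indicator simp: k2_def)
    then show ?thesis by simp
  qed
  have k2': "(\<integral>\<^sup>+r. k2 r * ennreal (r ^ 6) * indicator {0<..} r \<partial>lborel) = 1"
  proof -
    have "(\<integral>\<^sup>+r. ennreal (3 * r\<^sup>2) * indicator {0..1} r \<partial>lborel) = ennreal (1 ^ 3 - 0 ^ 3)"
      by (rule nn_integral_FTC_Icc) (auto intro!: derivative_eq_intros)
    moreover have "(\<integral>\<^sup>+r. k2 r * ennreal (r ^ 6) * indicator {0<..} r \<partial>lborel)
        = (\<integral>\<^sup>+r. ennreal (3 * r\<^sup>2) * indicator {0..1} r \<partial>lborel)"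
      by (intro nn_integral_cong_AE AE_mp[OF AE_lborel_singleton[of 0] AE_I2])
         (auto split: split_indicator simp: k2_def ennreal_mult[symmetric] power_numeral_reduce)
    ultimately show ?thesis by simp
  qed
  have gauss: "(\<integral>\<^sup>+x. \<Phi> x * ennreal (exp (- (norm x)\<^sup>2 / 2)) \<partial>lborel) = 48 * M"
    using homogeneous_layer_cake[of \<Phi> k1 3] hom by (simp add: k1 k1' M_def[symmetric]) (simp add: mult.commute)
  \<comment> \<open>By homogeneity \<open>\<Phi> (sgn x)\<close> is
    \<open>\<Phi> x / norm x ^ 3\<close>. The weight is split as
    \<open>1 + (1 / norm x ^ 3 - 1)\<close>, because only the second part vanishes at radius 1 and
    is a tail integral of \<open>k2\<close>. Each part contributes \<open>M\<close>.\<close>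
  have "(\<integral>\<^sup>+x. \<Phi> (sgn x) * indicator (ball 0 1) x \<partial>lborel)
      = (\<integral>\<^sup>+x. \<Phi> x * indicator (ball 0 1) x
          + \<Phi> x * (\<integral>\<^sup>+r. k2 r * indicator {norm x<..} r \<partial>lborel) \<partial>lborel)"
  proof (intro nn_integral_cong_AE AE_mp[OF AE_lborel_singleton[of 0] AE_I2] impI)
    fix x :: "real^3" assume x: "x \<noteq> 0"
    have *: "\<Phi> (sgn x) = ennreal (1 / norm x ^ 3) * \<Phi> x"
      using x hom[of "1 / norm x" x] by (simp add: sgn_div_norm divide_inverse power_inverse)
    show "\<Phi> (sgn x) * indicator (ball 0 1) x
        = \<Phi> x * indicator (ball 0 1) x + \<Phi> x * (\<integral>\<^sup>+r. k2 r * indicator {norm x<..} r \<partial>lborel)"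
    proof (cases "norm x < 1")
      case True
      then have "1 + ennreal (1 / norm x ^ 3 - 1) = ennreal (1 / norm x ^ 3)"
        using x by (subst ennreal_1[symmetric], subst ennreal_plus[symmetric])
          (auto simp: divide_simps power_le_one)
      then have "\<Phi> x + \<Phi> x * ennreal (1 / norm x ^ 3 - 1) = ennreal (1 / norm x ^ 3) * \<Phi> x"
        by (metis distrib_left mult.commute mult.right_neutral)
      then show ?thesis using True x by (simp add: k2 *)
    qed (simp add: k2_0)
  qed
  also have "\<dots> = M + (\<integral>\<^sup>+x. \<Phi> x * (\<integral>\<^sup>+r. k2 r * indicator {norm x<..} r \<partial>lborel) \<partial>lborel)"
    unfolding M_def greaterThan_def indicator_def by (rule nn_integral_add) simp_all
  also have "\<dots> = 2 * M"
    using homogeneous_layer_cake[of \<Phi> k2 3] hom by (simp add: k2' M_def mult_2)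
  finally have ball: "(\<integral>\<^sup>+x. \<Phi> (sgn x) * indicator (ball 0 1) x \<partial>lborel) = 2 * M" .
  have vol: "emeasure lborel (ball 0 1 :: (real^3) set) = ennreal (4 / 3 * pi)"
    by (simp add: emeasure_ball unit_ball_vol_3)
  have "(\<integral>\<^sup>+u. \<Phi> u \<partial>uniform_sphere) = 2 * M / ennreal (4 / 3 * pi)"
    unfolding uniform_sphere_def
    by (simp add: nn_integral_distr nn_integral_uniform_measure ball vol)
  \<comment> \<open>Origin of \<open>32 * pi\<close>: dividing \<open>2 * M\<close> by the volume
    \<open>4 / 3 * pi\<close> gives \<open>3 * M / (2 * pi)\<close>, while the Gaussian integral is
    \<open>48 * M\<close>.\<close>
  also have "\<dots> = 48 * M / ennreal (32 * pi)"
  proof -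
    have div: "y / ennreal c = y * ennreal (1 / c)" if "c > 0" for y :: ennreal and c :: real
      using that by (simp add: divide_ennreal_def inverse_ennreal inverse_eq_divide)
    have "ennreal 2 * ennreal (1 / (4 / 3 * pi)) = ennreal 48 * ennreal (1 / (32 * pi))"
      by (subst (1 2) ennreal_mult[symmetric]) auto
    then have "M * (ennreal 2 * ennreal (1 / (4 / 3 * pi))) = M * (ennreal 48 * ennreal (1 / (32 * pi)))"
      by (rule arg_cong)
    then show ?thesis by (subst (1 2) div) (simp_all add: mult_ac)
  qed
  finally show ?thesis unfolding gauss .
qed

section \<open>The Fourier kernel\<close>

text \<open>The mean of the product of \<open>1 - cos (ti * Yi)\<close>, \<open>i = 1, 2, 3\<close>,
  for centred jointly Gaussian variables of variance 1 with correlations \<open>p\<close>,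
  \<open>q\<close>, \<open>r\<close>. It is written with cosh and sinh to isolate the only term that
  is sensitive to the sign of \<open>p * q * r\<close>.\<close>

definition cos_kernel :: "real \<Rightarrow> real \<Rightarrow> real \<Rightarrow> real \<Rightarrow> real \<Rightarrow> real \<Rightarrow> real" where
  "cos_kernel p q r t1 t2 t3 = (let e = (\<lambda>t. exp (- t\<^sup>2 / 2)); A = p * t1 * t2; B = q * t1 * t3; C = r * t2 * t3 in
     1 - e t1 - e t2 - e t3 + e t1 * e t2 * cosh A + e t1 * e t3 * cosh B + e t2 * e t3 * cosh C
     - e t1 * e t2 * e t3 * (cosh A * cosh B * cosh C - sinh A * sinh B * sinh C))"

text \<open>Product-to-sum form: each remaining cosine has a linear form as argument and therefore
  an explicit Gaussian mean.\<close>

lemma prod_one_minus_cos: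
  fixes u v w :: real
  shows "(1 - cos u) * (1 - cos v) * (1 - cos w) = 1 - cos u - cos v - cos w
    + (cos (u + v) + cos (u - v)) / 2 + (cos (u + w) + cos (u - w)) / 2 + (cos (v + w) + cos (v - w)) / 2
    - (cos (u + v + w) + cos (u + v - w) + cos (u - v + w) + cos (u - v - w)) / 4"
  by (simp add: cos_add cos_diff sin_add sin_diff algebra_simps)

text \<open>Of the eight exponentials with exponents \<open>A\<close>, \<open>B\<close>,
  \<open>C\<close> up to sign, subtracting the sinh product cancels those with an even number of
  minus signs and doubles the others. The survivors are the exponents
  \<open>- (s * A + u * B + s * u * C)\<close> with \<open>s\<close>, \<open>u\<close> equal to 1 or
  -1, as they arise from the vectors \<open>a + s b + u c\<close>.\<close>

lemma cosh_cosh_cosh_minus_sinh_sinh_sinh: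
  fixes A B C :: real
  shows "cosh A * cosh B * cosh C - sinh A * sinh B * sinh C
    = (exp (- A - B - C) + exp (- A + B + C) + exp (A - B + C) + exp (A + B - C)) / 4"
  by (simp add: cosh_def sinh_def exp_add exp_diff exp_minus field_simps)

lemma gaussian_cos_kernel:
  fixes n1 n2 n3 :: "real^3"
  assumes n: "norm n1 = 1" "norm n2 = 1" "norm n3 = 1"
  shows "has_bochner_integral lborel
     (\<lambda>x. (1 - cos (t1 * (x \<bullet> n1))) * (1 - cos (t2 * (x \<bullet> n2))) * (1 - cos (t3 * (x \<bullet> n3)))
        * exp (- (norm x)\<^sup>2 / 2))
     (sqrt (2 * pi) ^ 3 * cos_kernel (n1 \<bullet> n2) (n1 \<bullet> n3) (n2 \<bullet> n3) t1 t2 t3)"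
proof -
  define g :: "real^3 \<Rightarrow> real" where "g = (\<lambda>x. exp (- (norm x)\<^sup>2 / 2))"
  define K where "K = sqrt (2 * pi) ^ 3"
  define p q r where "p = n1 \<bullet> n2" and "q = n1 \<bullet> n3" and "r = n2 \<bullet> n3"
  \<comment> \<open>With the frequencies absorbed into the vectors, every cosine in the expansion is
    \<open>cos (x \<bullet> v)\<close> with \<open>v\<close> a signed sum of \<open>a\<close>,
    \<open>b\<close>, \<open>c\<close>, and its mean is read off from \<open>g v\<close>.\<close>
  define a b c where "a = t1 *\<^sub>R n1" and "b = t2 *\<^sub>R n2" and "c = t3 *\<^sub>R n3"
  define A B C where "A = p * t1 * t2" and "B = q * t1 * t3" and "C = r * t2 * t3"
  define e where "e = (\<lambda>t::real. exp (- t\<^sup>2 / 2))"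
  have h: "has_bochner_integral lborel (\<lambda>x. cos (x \<bullet> v) * g x) (K * g v)" for v
    using gaussian_cos_integral[of v] by (simp add: g_def K_def)
  have inn: "a \<bullet> a = t1\<^sup>2" "b \<bullet> b = t2\<^sup>2" "c \<bullet> c = t3\<^sup>2" "a \<bullet> b = A" "a \<bullet> c = B" "b \<bullet> c = C"
    "b \<bullet> a = A" "c \<bullet> a = B" "c \<bullet> b = C"
    using n by (simp_all add: a_def b_def c_def A_def B_def C_def p_def q_def r_def norm_eq_1
        power2_eq_square inner_commute mult_ac)
  have g: "g v = exp (- (v \<bullet> v) / 2)" for v
    by (simp add: g_def power2_norm_eq_inner)
  have g1: "g 0 = 1" "g a = e t1" "g b = e t2" "g c = e t3"
    by (simp_all add: g inn e_def)
  have g2: "g (a + b) = e t1 * e t2 * exp (- A)" "g (a - b) = e t1 * e t2 * exp A"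
    "g (a + c) = e t1 * e t3 * exp (- B)" "g (a - c) = e t1 * e t3 * exp B"
    "g (b + c) = e t2 * e t3 * exp (- C)" "g (b - c) = e t2 * e t3 * exp C"
    by (simp_all add: g e_def inner_add_left inner_add_right inner_diff_left inner_diff_right inn
        exp_add[symmetric] field_simps)
  have g3: "g (a + b + c) = e t1 * e t2 * e t3 * exp (- A - B - C)"
    "g (a + b - c) = e t1 * e t2 * e t3 * exp (- A + B + C)"
    "g (a - b + c) = e t1 * e t2 * e t3 * exp (A - B + C)"
    "g (a - b - c) = e t1 * e t2 * e t3 * exp (A + B - C)"
    by (simp_all add: g e_def inner_add_left inner_add_right inner_diff_left inner_diff_right inn
        exp_add[symmetric] field_simps)
  let ?c = "\<lambda>v x. cos (x \<bullet> v) * g x"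
  have "has_bochner_integral lborel (\<lambda>x. ?c 0 x - ?c a x - ?c b x - ?c c x
      + (?c (a + b) x + ?c (a - b) x) / 2 + (?c (a + c) x + ?c (a - c) x) / 2
      + (?c (b + c) x + ?c (b - c) x) / 2
      - (?c (a + b + c) x + ?c (a + b - c) x + ?c (a - b + c) x + ?c (a - b - c) x) / 4)
     (K * g 0 - K * g a - K * g b - K * g c
      + (K * g (a + b) + K * g (a - b)) / 2 + (K * g (a + c) + K * g (a - c)) / 2
      + (K * g (b + c) + K * g (b - c)) / 2
      - (K * g (a + b + c) + K * g (a + b - c) + K * g (a - b + c) + K * g (a - b - c)) / 4)"
    (is "has_bochner_integral _ ?F ?V")
    by (intro has_bochner_integral_diff has_bochner_integral_add has_bochner_integral_divide_zero h)
  moreover have "?F = (\<lambda>x. (1 - cos (t1 * (x \<bullet> n1))) * (1 - cos (t2 * (x \<bullet> n2)))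
      * (1 - cos (t3 * (x \<bullet> n3))) * g x)"
    unfolding prod_one_minus_cos
    by (simp add: fun_eq_iff inner_add_right inner_diff_right a_def b_def c_def field_simps)
  moreover have "?V = K * cos_kernel p q r t1 t2 t3"
    unfolding cos_kernel_def Let_def e_def[symmetric] A_def[symmetric] B_def[symmetric] C_def[symmetric]
      cosh_cosh_cosh_minus_sinh_sinh_sinh g1 g2 g3
    by (simp add: cosh_field_def algebra_simps add_divide_distrib)
  ultimately show ?thesis
    by (simp add: K_def g_def p_def q_def r_def)
qed

section \<open>Tonelli on triples and the triple Fourier integral\<close>

abbreviation lborel3 :: "(real \<times> real \<times> real) measure" where
  "lborel3 \<equiv> lborel \<Otimes>\<^sub>M (lborel \<Otimes>\<^sub>M lborel)"

lemma Fubini_lborel3: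
  fixes f :: "real \<times> real \<times> real \<Rightarrow> 'b :: euclidean_space \<Rightarrow> ennreal"
  assumes "case_prod f \<in> borel_measurable (lborel3 \<Otimes>\<^sub>M lborel)"
  shows "(\<integral>\<^sup>+x. \<integral>\<^sup>+t. f t x \<partial>lborel3 \<partial>lborel) = (\<integral>\<^sup>+t. \<integral>\<^sup>+x. f t x \<partial>lborel \<partial>lborel3)"
  using lborel_pair.Fubini'[of f] assms by (simp add: lborel_prod)

lemma nn_integral_lborel3:
  assumes [measurable]: "f \<in> borel_measurable lborel3"
  shows "(\<integral>\<^sup>+t. f t \<partial>lborel3) = (\<integral>\<^sup>+x. \<integral>\<^sup>+y. \<integral>\<^sup>+z. f (x, y, z) \<partial>lborel \<partial>lborel \<partial>lborel)"
proof -
  have sf: "sigma_finite_measure (lborel \<Otimes>\<^sub>M lborel :: (real \<times> real) measure)"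
    by (simp add: lborel_prod sigma_finite_lborel)
  have "(\<integral>\<^sup>+t. f t \<partial>lborel3) = (\<integral>\<^sup>+x. \<integral>\<^sup>+s. f (x, s) \<partial>(lborel \<Otimes>\<^sub>M lborel) \<partial>lborel)"
    by (rule sigma_finite_measure.nn_integral_fst[OF sf assms, symmetric])
  also have "\<dots> = (\<integral>\<^sup>+x. \<integral>\<^sup>+y. \<integral>\<^sup>+z. f (x, y, z) \<partial>lborel \<partial>lborel \<partial>lborel)"
    by (intro nn_integral_cong, subst lborel.nn_integral_fst[symmetric]) auto
  finally show ?thesis .
qed

lemma nn_integral_lborel3_prod:
  assumes [measurable]: "f \<in> borel_measurable borel" "g \<in> borel_measurable borel" "h \<in> borel_measurable borel"
  shows "(\<integral>\<^sup>+(x, y, z). f x * g y * h z \<partial>lborel3)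
    = (\<integral>\<^sup>+x. f x \<partial>lborel) * (\<integral>\<^sup>+y. g y \<partial>lborel) * (\<integral>\<^sup>+z. h z \<partial>lborel)"
  by (subst nn_integral_lborel3)
     (simp_all add: nn_integral_cmult nn_integral_multc mult.assoc)

lemma nn_integral_gaussian_abs_prod:
  fixes n1 n2 n3 :: "real^3"
  assumes n: "norm n1 = 1" "norm n2 = 1" "norm n3 = 1"
  shows "ennreal (pi ^ 3) * (\<integral>\<^sup>+x. ennreal (\<bar>x \<bullet> n1\<bar> * \<bar>x \<bullet> n2\<bar> * \<bar>x \<bullet> n3\<bar>) * ennreal (exp (- (norm x)\<^sup>2 / 2)) \<partial>lborel)
    = (\<integral>\<^sup>+(t1, t2, t3). ennreal (sqrt (2 * pi) ^ 3
          * cos_kernel (n1 \<bullet> n2) (n1 \<bullet> n3) (n2 \<bullet> n3) t1 t2 t3 / (t1\<^sup>2 * t2\<^sup>2 * t3\<^sup>2)) \<partial>lborel3)"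
    (is "_ * (\<integral>\<^sup>+x. ennreal (?a x) * ennreal (?g x) \<partial>lborel) = ?R")
proof -
  define f where "f = (\<lambda>n (x :: real^3) t. (1 - cos (t * (x \<bullet> n))) / t\<^sup>2)"
  have f0: "f n x t \<ge> 0" for n x t by (simp add: f_def)
  have [measurable]: "(\<lambda>(x, t). f n x t) \<in> borel_measurable (borel \<Otimes>\<^sub>M borel)"
    "f n x \<in> borel_measurable borel" for n x by (simp_all add: f_def)
  have "ennreal (pi ^ 3) * (\<integral>\<^sup>+x. ennreal (?a x) * ennreal (?g x) \<partial>lborel)
      = (\<integral>\<^sup>+x. ennreal (pi ^ 3) * (ennreal (?a x) * ennreal (?g x)) \<partial>lborel)"
    by (rule nn_integral_cmult[symmetric]) simp
  also have "\<dots> = (\<integral>\<^sup>+x. ennreal (?g x) * (\<integral>\<^sup>+(t1, t2, t3). ennreal (f n1 x t1) * ennreal (f n2 x t2)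
      * ennreal (f n3 x t3) \<partial>lborel3) \<partial>lborel)"
  proof (rule nn_integral_cong)
    fix x :: "real^3"
    have "(\<integral>\<^sup>+(t1, t2, t3). ennreal (f n1 x t1) * ennreal (f n2 x t2) * ennreal (f n3 x t3) \<partial>lborel3)
        = ennreal (pi * \<bar>x \<bullet> n1\<bar>) * ennreal (pi * \<bar>x \<bullet> n2\<bar>) * ennreal (pi * \<bar>x \<bullet> n3\<bar>)"
      by (subst nn_integral_lborel3_prod) (auto simp: nn_integral_one_minus_cos f_def)
    then show "ennreal (pi ^ 3) * (ennreal (?a x) * ennreal (?g x)) = ennreal (?g x)
        * (\<integral>\<^sup>+(t1, t2, t3). ennreal (f n1 x t1) * ennreal (f n2 x t2) * ennreal (f n3 x t3) \<partial>lborel3)"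
      by (simp add: ennreal_mult[symmetric] power3_eq_cube mult_ac)
  qed
  also have "\<dots> = (\<integral>\<^sup>+x. \<integral>\<^sup>+t. (case t of (t1, t2, t3) \<Rightarrow>
      ennreal (f n1 x t1 * f n2 x t2 * f n3 x t3 * ?g x)) \<partial>lborel3 \<partial>lborel)"
    by (intro nn_integral_cong, subst nn_integral_cmult[symmetric])
       (auto intro!: nn_integral_cong simp: ennreal_mult f0 mult_ac split: prod.splits)
  also have "\<dots> = (\<integral>\<^sup>+t. \<integral>\<^sup>+x. (case t of (t1, t2, t3) \<Rightarrow>
      ennreal (f n1 x t1 * f n2 x t2 * f n3 x t3 * ?g x)) \<partial>lborel \<partial>lborel3)"
    by (rule Fubini_lborel3) measurable
  also have "\<dots> = ?R"
  proof (intro nn_integral_cong, clarify)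
    fix t1 t2 t3 :: real
    \<comment> \<open>No case split at vanishing \<open>t1\<close>, \<open>t2\<close> or
      \<open>t3\<close>: division by zero makes both sides 0 there.\<close>
    have "has_bochner_integral lborel (\<lambda>x. f n1 x t1 * f n2 x t2 * f n3 x t3 * ?g x)
      (sqrt (2 * pi) ^ 3 * cos_kernel (n1 \<bullet> n2) (n1 \<bullet> n3) (n2 \<bullet> n3) t1 t2 t3 / (t1\<^sup>2 * t2\<^sup>2 * t3\<^sup>2))"
      using has_bochner_integral_divide_zero[OF gaussian_cos_kernel[OF n, of t1 t2 t3], of "t1\<^sup>2 * t2\<^sup>2 * t3\<^sup>2"]
      by (simp add: f_def)
    then show "(\<integral>\<^sup>+x. ennreal (f n1 x t1 * f n2 x t2 * f n3 x t3 * ?g x) \<partial>lborel)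
      = ennreal (sqrt (2 * pi) ^ 3 * cos_kernel (n1 \<bullet> n2) (n1 \<bullet> n3) (n2 \<bullet> n3) t1 t2 t3 / (t1\<^sup>2 * t2\<^sup>2 * t3\<^sup>2))"
      by (subst nn_integral_eq_integral) (auto simp: has_bochner_integral_iff f0)
  qed
  finally show ?thesis .
qed

section \<open>The sinh kernel as a box integral\<close>

text \<open>Determinant of the symmetric matrix with unit diagonal and signed entries
  \<open>x\<close>, \<open>y\<close>, \<open>z\<close>. For \<open>s\<close> equal to 1 or -1,
  \<open>Delta s a b c\<close> is \<open>gram_det a b (s * c)\<close>.\<close>

definition gram_det :: "real \<Rightarrow> real \<Rightarrow> real \<Rightarrow> real" where
  "gram_det x y z = 1 - x\<^sup>2 - y\<^sup>2 - z\<^sup>2 + 2 * x * y * z"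

lemma nn_integral_lborel3_curried:
  assumes "(\<lambda>(x, y, z). f x y z) \<in> borel_measurable lborel3"
  shows "(\<integral>\<^sup>+(x, y, z). f x y z \<partial>lborel3) = (\<integral>\<^sup>+x. \<integral>\<^sup>+y. \<integral>\<^sup>+z. f x y z \<partial>lborel \<partial>lborel \<partial>lborel)"
  using nn_integral_lborel3[OF assms] by simp

text \<open>Completing the square in \<open>t3\<close>, then \<open>t2\<close>, then
  \<open>t1\<close> gives the pivots 1, \<open>1 - z\<^sup>2\<close> and
  \<open>D / (1 - z\<^sup>2)\<close>, whose product is the determinant. The bound on
  \<open>z\<close> makes the middle pivot positive.\<close>

lemma nn_integral_gaussian3:
  assumes D: "gram_det x y z > 0" and z: "\<bar>z\<bar> < 1"
  shows "(\<integral>\<^sup>+(t1, t2, t3). ennreal (exp (- (t1\<^sup>2 + t2\<^sup>2 + t3\<^sup>2) / 2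
      - (x * t1 * t2 + y * t1 * t3 + z * t2 * t3))) \<partial>lborel3)
    = ennreal (sqrt (2 * pi) ^ 3 / sqrt (gram_det x y z))"
proof -
  define D where "D = gram_det x y z"
  define s where "s = 1 - z\<^sup>2"
  have s: "s > 0" using z by (simp add: s_def abs_square_less_1)
  have D0: "D > 0" using D by (simp add: D_def)
  \<comment> \<open>Schur complement: eliminating \<open>t3\<close> leaves the 2 by 2 matrix with
    diagonal \<open>1 - y\<^sup>2\<close>, \<open>s\<close> and off-diagonal entry
    \<open>x - y * z\<close>.\<close>
  have Ds: "D = (1 - y\<^sup>2) * s - (x - y * z)\<^sup>2"
    by (simp add: D_def gram_det_def s_def power2_eq_square algebra_simps)
  have i3: "(\<integral>\<^sup>+t3. ennreal (exp (- (t1\<^sup>2 + t2\<^sup>2 + t3\<^sup>2) / 2 - (x * t1 * t2 + y * t1 * t3 + z * t2 * t3))) \<partial>lborel)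
      = ennreal (sqrt (2 * pi)) * ennreal (exp (- (t1\<^sup>2 * (D / s)) / 2))
        * ennreal (exp (- (s * (t2 - (- t1 * (x - y * z) / s))\<^sup>2) / 2))" for t1 t2
  proof -
    have "- (t1\<^sup>2 + t2\<^sup>2 + t3\<^sup>2) / 2 - (x * t1 * t2 + y * t1 * t3 + z * t2 * t3)
        = (- (t1\<^sup>2 * (D / s)) / 2) + (- (s * (t2 - (- t1 * (x - y * z) / s))\<^sup>2) / 2)
          + (- (1 * (t3 - (- (y * t1 + z * t2)))\<^sup>2) / 2)" for t3
    proof -
      have "t1\<^sup>2 * (D / s) + s * (t2 - (- t1 * (x - y * z) / s))\<^sup>2
          = t1\<^sup>2 * ((D + (x - y * z)\<^sup>2) / s) + s * t2\<^sup>2 + 2 * t1 * t2 * (x - y * z)"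
        using s by (simp add: field_simps power2_eq_square)
      also have "(D + (x - y * z)\<^sup>2) / s = 1 - y\<^sup>2"
        using s by (simp add: Ds)
      finally have "s * (t2 - (- t1 * (x - y * z) / s))\<^sup>2
          = t1\<^sup>2 * (1 - y\<^sup>2) + (1 - z\<^sup>2) * t2\<^sup>2 + 2 * t1 * t2 * (x - y * z) - t1\<^sup>2 * (D / s)"
        by (simp add: s_def)
      then show ?thesis
        by (simp only:) (simp add: power2_eq_square algebra_simps add_divide_distrib diff_divide_distrib)
    qed
    then have "(\<integral>\<^sup>+t3. ennreal (exp (- (t1\<^sup>2 + t2\<^sup>2 + t3\<^sup>2) / 2 - (x * t1 * t2 + y * t1 * t3 + z * t2 * t3))) \<partial>lborel)
        = (\<integral>\<^sup>+t3. ennreal (exp (- (t1\<^sup>2 * (D / s)) / 2))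
            * ennreal (exp (- (s * (t2 - (- t1 * (x - y * z) / s))\<^sup>2) / 2))
            * ennreal (exp (- (1 * (t3 - (- (y * t1 + z * t2)))\<^sup>2) / 2)) \<partial>lborel)"
      by (simp only: exp_add ennreal_mult exp_ge_zero mult_nonneg_nonneg)
    then show ?thesis
      by (subst (asm) nn_integral_cmult, simp, subst (asm) nn_integral_gaussian) (simp_all add: mult_ac)
  qed
  have i2: "(\<integral>\<^sup>+t2. ennreal (sqrt (2 * pi)) * ennreal (exp (- (t1\<^sup>2 * (D / s)) / 2))
        * ennreal (exp (- (s * (t2 - (- t1 * (x - y * z) / s))\<^sup>2) / 2)) \<partial>lborel)
      = ennreal (sqrt (2 * pi)) * ennreal (sqrt (2 * pi / s))
        * ennreal (exp (- (D / s * (t1 - 0)\<^sup>2) / 2))" for t1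
    by (subst nn_integral_cmult, simp, subst nn_integral_gaussian[OF s]) (simp add: mult_ac)
  have "(\<integral>\<^sup>+(t1, t2, t3). ennreal (exp (- (t1\<^sup>2 + t2\<^sup>2 + t3\<^sup>2) / 2
      - (x * t1 * t2 + y * t1 * t3 + z * t2 * t3))) \<partial>lborel3)
      = (\<integral>\<^sup>+t1. \<integral>\<^sup>+t2. \<integral>\<^sup>+t3. ennreal (exp (- (t1\<^sup>2 + t2\<^sup>2 + t3\<^sup>2) / 2
      - (x * t1 * t2 + y * t1 * t3 + z * t2 * t3))) \<partial>lborel \<partial>lborel \<partial>lborel)"
    by (rule nn_integral_lborel3_curried) (unfold case_prod_beta', measurable)
  also have "\<dots> = ennreal (sqrt (2 * pi)) * ennreal (sqrt (2 * pi / s)) * ennreal (sqrt (2 * pi / (D / s)))"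
    unfolding i3 i2 using D0 s by (subst nn_integral_cmult, simp, subst nn_integral_gaussian) auto
  also have "\<dots> = ennreal (sqrt (2 * pi) ^ 3 / sqrt D)"
    using D0 s by (simp add: ennreal_mult[symmetric] real_sqrt_divide real_sqrt_mult power3_eq_cube)
  finally show ?thesis by (simp add: D_def)
qed

lemma sinh_divide_eq_nn_integral:
  fixes a u :: real
  assumes "a \<ge> 0" "u \<noteq> 0"
  shows "ennreal (sinh (a * u) / u) = (\<integral>\<^sup>+x. ennreal (exp (- (x * u)) / 2) * indicator {-a..a} x \<partial>lborel)"
proof -
  have "(\<integral>\<^sup>+x. ennreal (exp (- (x * u)) / 2) * indicator {-a..a} x \<partial>lborel)
      = ennreal (- exp (- (a * u)) / (2 * u) - (- exp (- ((-a) * u)) / (2 * u)))"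
    using assms by (intro nn_integral_FTC_Icc) (auto intro!: derivative_eq_intros)
  also have "- exp (- (a * u)) / (2 * u) - (- exp (- ((-a) * u)) / (2 * u)) = sinh (a * u) / u"
    using assms by (simp add: sinh_field_def field_simps)
  finally show ?thesis by simp
qed

lemma nn_integral_Icc_even:
  fixes h :: "real \<Rightarrow> ennreal"
  assumes [measurable]: "h \<in> borel_measurable borel" and even: "\<And>x. h (- x) = h x" and a: "a \<ge> 0"
  shows "(\<integral>\<^sup>+x. h x * indicator {-a..a} x \<partial>lborel) = 2 * (\<integral>\<^sup>+x. h x * indicator {0..a} x \<partial>lborel)"
proof -
  have "(\<integral>\<^sup>+x. h x * indicator {-a..a} x \<partial>lborel)
      = (\<integral>\<^sup>+x. h x * indicator {0..a} x + h (- x) * indicator {0..a} (- x) \<partial>lborel)"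
    using a by (intro nn_integral_cong_AE AE_mp[OF AE_lborel_singleton[of 0] AE_I2])
      (auto split: split_indicator simp: even)
  also have "\<dots> = (\<integral>\<^sup>+x. h x * indicator {0..a} x \<partial>lborel) + (\<integral>\<^sup>+x. h (- x) * indicator {0..a} (- x) \<partial>lborel)"
    by (rule nn_integral_add) simp_all
  also have "(\<integral>\<^sup>+x. h (- x) * indicator {0..a} (- x) \<partial>lborel) = (\<integral>\<^sup>+x. h x * indicator {0..a} x \<partial>lborel)"
    using nn_integral_real_affine[of "\<lambda>x. h x * indicator {0..a} x" "-1" 0] by simp
  finally show ?thesis by (simp add: mult_2)
qed

lemma nn_integral_Icc_reflect:
  fixes h :: "real \<Rightarrow> ennreal"
  assumes [measurable]: "h \<in> borel_measurable borel"
  shows "(\<integral>\<^sup>+x. h (- x) * indicator {-a..a} x \<partial>lborel) = (\<integral>\<^sup>+x. h x * indicator {-a..a} x \<partial>lborel)"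
proof -
  have "(\<integral>\<^sup>+x. h x * indicator {-a..a} x \<partial>lborel) = (\<integral>\<^sup>+x. h (- x) * indicator {-a..a} (- x) \<partial>lborel)"
    using nn_integral_real_affine[of "\<lambda>x. h x * indicator {-a..a} x" "-1" 0] by simp
  also have "\<dots> = (\<integral>\<^sup>+x. h (- x) * indicator {-a..a} x \<partial>lborel)"
    by (intro nn_integral_cong) (auto split: split_indicator)
  finally show ?thesis by simp
qed

text \<open>Replacing the squares by their maxima and \<open>x * y * z\<close> by
  \<open>- (a * b * c)\<close> bounds the determinant below by \<open>Delta (- 1) a b c\<close>.
  Strictness in \<open>x\<close> alone gives positivity even when this bound is 0, and it excludes
  only the null faces \<open>x = a\<close> and \<open>x = - a\<close>.\<close>

lemma gram_det_pos:
  assumes "0 < b" "0 < c"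
    and D: "Delta (- 1) a b c \<ge> 0" and x: "\<bar>x\<bar> < a" and y: "\<bar>y\<bar> \<le> b" and z: "\<bar>z\<bar> \<le> c"
  shows "gram_det x y z > 0"
proof -
  have "x\<^sup>2 < a\<^sup>2" "y\<^sup>2 \<le> b\<^sup>2" "z\<^sup>2 \<le> c\<^sup>2"
    using assms power_strict_mono[of "\<bar>x\<bar>" a 2] power_mono[of "\<bar>y\<bar>" b 2] power_mono[of "\<bar>z\<bar>" c 2] by auto
  moreover have "\<bar>x * y * z\<bar> \<le> a * b * c"
    unfolding abs_mult using assms by (intro mult_mono mult_nonneg_nonneg) auto
  then have "2 * x * y * z \<ge> - (2 * a * b * c)" by (simp add: mult.assoc abs_le_iff)
  ultimately show ?thesis using D by (simp add: gram_det_def Delta_def)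
qed

lemma borel_measurable_J_integrand [measurable]:
  "(\<lambda>w. J_integrand (fst w) (fst (snd w)) (snd (snd w))) \<in> borel_measurable lborel3"
  "J_integrand x y \<in> borel_measurable borel"
  unfolding J_integrand_def[abs_def] by measurable

lemma J_integrand_eq: "J_integrand x y z = 1 / sqrt (gram_det x y z)"
  by (simp add: J_integrand_def gram_det_def)

text \<open>Flipping \<open>x\<close> or \<open>y\<close> has the same effect on the integrand as
  flipping \<open>z\<close>, and the \<open>z\<close>-interval is symmetric. So the
  \<open>z\<close>-integral \<open>j\<close> is even in \<open>x\<close> and in \<open>y\<close>,
  each giving a factor 2. Flipping \<open>z\<close> alone changes the integrand, so that interval
  stays two-sided.\<close>

lemma nn_integral_J_integrand_symmetric:
  assumes "a \<ge> 0" "b \<ge> 0"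
  shows "(\<integral>\<^sup>+(x, y, z). ennreal (J_integrand x y z)
      * (indicator {-a..a} x * indicator {-b..b} y * indicator {-c..c} z) \<partial>lborel3)
    = 4 * (\<integral>\<^sup>+(x, y, z). ennreal (J_integrand x y z) * indicator ({0..a} \<times> {0..b} \<times> {-c..c}) (x, y, z) \<partial>lborel3)"
proof -
  define j where "j = (\<lambda>x y. \<integral>\<^sup>+z. ennreal (J_integrand x y z) * indicator {-c..c} z \<partial>lborel)"
  have [measurable]: "(\<lambda>(x, y). j x y) \<in> borel_measurable (lborel \<Otimes>\<^sub>M lborel)" "j x \<in> borel_measurable lborel" for x
    unfolding j_def J_integrand_def by measurable
  have iter: "(\<integral>\<^sup>+(x, y, z). ennreal (J_integrand x y z)
      * (indicator A x * indicator B y * indicator {-c..c} z) \<partial>lborel3)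
    = (\<integral>\<^sup>+x. (\<integral>\<^sup>+y. j x y * indicator B y \<partial>lborel) * indicator A x \<partial>lborel)"
    if [measurable]: "A \<in> sets borel" "B \<in> sets borel" for A B :: "real set"
  proof -
    have "(\<integral>\<^sup>+(x, y, z). ennreal (J_integrand x y z)
        * (indicator A x * indicator B y * indicator {-c..c} z) \<partial>lborel3)
      = (\<integral>\<^sup>+x. \<integral>\<^sup>+y. \<integral>\<^sup>+z. ennreal (J_integrand x y z)
        * (indicator A x * indicator B y * indicator {-c..c} z) \<partial>lborel \<partial>lborel \<partial>lborel)"
      by (rule nn_integral_lborel3_curried) (unfold case_prod_beta', measurable)
    also have "\<dots> = (\<integral>\<^sup>+x. \<integral>\<^sup>+y. j x y * indicator B y * indicator A x \<partial>lborel \<partial>lborel)"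
    proof (intro nn_integral_cong)
      fix x y :: real
      have "(\<integral>\<^sup>+z. ennreal (J_integrand x y z) * (indicator A x * indicator B y * indicator {-c..c} z) \<partial>lborel)
          = (\<integral>\<^sup>+z. (ennreal (J_integrand x y z) * indicator {-c..c} z) * (indicator B y * indicator A x) \<partial>lborel)"
        by (intro nn_integral_cong) (simp add: mult_ac)
      also have "\<dots> = j x y * (indicator B y * indicator A x)"
        unfolding j_def by (rule nn_integral_multc) measurable
      finally show "(\<integral>\<^sup>+z. ennreal (J_integrand x y z) * (indicator A x * indicator B y * indicator {-c..c} z) \<partial>lborel)
          = j x y * indicator B y * indicator A x" by (simp add: mult.assoc)
    qed
    also have "\<dots> = (\<integral>\<^sup>+x. (\<integral>\<^sup>+y. j x y * indicator B y \<partial>lborel) * indicator A x \<partial>lborel)"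
      by (intro nn_integral_cong nn_integral_multc) measurable
    finally show ?thesis .
  qed
  have j_neg1: "j (- x) y = j x y" for x y
  proof -
    have "J_integrand (- x) y z = J_integrand x y (- z)" for z by (simp add: J_integrand_def)
    then show ?thesis
      using nn_integral_Icc_reflect[of "\<lambda>z. ennreal (J_integrand x y z)" c] by (simp add: j_def)
  qed
  have j_neg2: "j x (- y) = j x y" for x y
  proof -
    have "J_integrand x (- y) z = J_integrand x y (- z)" for z by (simp add: J_integrand_def)
    then show ?thesis
      using nn_integral_Icc_reflect[of "\<lambda>z. ennreal (J_integrand x y z)" c] by (simp add: j_def)
  qed
  have "(\<integral>\<^sup>+x. (\<integral>\<^sup>+y. j x y * indicator {-b..b} y \<partial>lborel) * indicator {-a..a} x \<partial>lborel)
      = 2 * (\<integral>\<^sup>+x. (\<integral>\<^sup>+y. j x y * indicator {-b..b} y \<partial>lborel) * indicator {0..a} x \<partial>lborel)"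
    using assms by (intro nn_integral_Icc_even) (measurable, simp_all add: j_neg1)
  also have "\<dots> = 2 * (\<integral>\<^sup>+x. 2 * ((\<integral>\<^sup>+y. j x y * indicator {0..b} y \<partial>lborel) * indicator {0..a} x) \<partial>lborel)"
    using assms by (subst nn_integral_Icc_even) (simp_all add: j_neg2 mult.assoc)
  also have "\<dots> = 4 * (\<integral>\<^sup>+x. (\<integral>\<^sup>+y. j x y * indicator {0..b} y \<partial>lborel) * indicator {0..a} x \<partial>lborel)"
    by (subst nn_integral_cmult) (simp_all add: mult.assoc[symmetric])
  finally have "(\<integral>\<^sup>+x. (\<integral>\<^sup>+y. j x y * indicator {-b..b} y \<partial>lborel) * indicator {-a..a} x \<partial>lborel)
      = 4 * (\<integral>\<^sup>+x. (\<integral>\<^sup>+y. j x y * indicator {0..b} y \<partial>lborel) * indicator {0..a} x \<partial>lborel)" .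
  moreover have "indicator ({0..a} \<times> {0..b} \<times> {-c..c}) (x, y, z)
      = (indicator {0..a} x * indicator {0..b} y * indicator {-c..c} z :: ennreal)" for x y z
    by (auto split: split_indicator)
  ultimately show ?thesis
    by (simp only: iter[OF borel_closed borel_closed] closed_atLeastAtMost)
qed

lemma borel_measurable_sinh [measurable (raw)]:
  fixes f :: "'a \<Rightarrow> real"
  assumes [measurable]: "f \<in> borel_measurable M"
  shows "(\<lambda>x. sinh (f x)) \<in> borel_measurable M"
  unfolding sinh_field_def by measurable

lemma nn_integral_sinh_kernel:
  assumes a: "0 < a" and b: "0 < b" and c: "0 < c" "c < 1" and D: "Delta (- 1) a b c \<ge> 0"
  shows "(\<integral>\<^sup>+(t1, t2, t3). ennreal (exp (- (t1\<^sup>2 + t2\<^sup>2 + t3\<^sup>2) / 2)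
      * (sinh (a * t1 * t2) * sinh (b * t1 * t3) * sinh (c * t2 * t3)) / (t1\<^sup>2 * t2\<^sup>2 * t3\<^sup>2)) \<partial>lborel3)
    = ennreal (sqrt (2 * pi) ^ 3 / 2)
      * (\<integral>\<^sup>+(x, y, z). ennreal (J_integrand x y z) * indicator ({0..a} \<times> {0..b} \<times> {-c..c}) (x, y, z) \<partial>lborel3)"
    (is "?L = ?R")
proof -
  \<comment> \<open>Joint integrand in the frequencies \<open>t\<close> and the box variables; the 8
    collects the three factors \<open>1 / 2\<close> from
    \<open>sinh_divide_eq_nn_integral\<close>.\<close>
  define F where "F = (\<lambda>(t1, t2, t3) (x, y, z). ennreal (exp (- (t1\<^sup>2 + t2\<^sup>2 + t3\<^sup>2) / 2
      - (x * t1 * t2 + y * t1 * t3 + z * t2 * t3)) / 8)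
      * (indicator {-a..a} x * indicator {-b..b} y * indicator {-c..c} z))"
  have F_m: "case_prod F \<in> borel_measurable (lborel3 \<Otimes>\<^sub>M lborel3)"
    unfolding F_def case_prod_beta' by measurable
  have F_m': "case_prod F \<in> borel_measurable (lborel3 \<Otimes>\<^sub>M lborel)"
    using F_m by (simp add: lborel_prod)
  have Fp_m: "(\<lambda>t. \<integral>\<^sup>+p. F t p \<partial>lborel3) \<in> borel_measurable lborel3"
    using lborel.borel_measurable_nn_integral[of F lborel3] F_m by (simp add: lborel_prod)
  have Ft_m: "(\<lambda>p. \<integral>\<^sup>+t. F t p \<partial>lborel3) \<in> borel_measurable lborel3"
    using lborel.borel_measurable_nn_integral[of "\<lambda>p t. F t p" lborel3]
      measurable_compose[OF measurable_pair_swap' F_m] by (simp add: lborel_prod case_prod_beta')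
  have "?L = (\<integral>\<^sup>+t1. \<integral>\<^sup>+t2. \<integral>\<^sup>+t3. ennreal (exp (- (t1\<^sup>2 + t2\<^sup>2 + t3\<^sup>2) / 2)
      * (sinh (a * t1 * t2) * sinh (b * t1 * t3) * sinh (c * t2 * t3)) / (t1\<^sup>2 * t2\<^sup>2 * t3\<^sup>2)) \<partial>lborel \<partial>lborel \<partial>lborel)"
    by (rule nn_integral_lborel3_curried) (unfold case_prod_beta', measurable)
  also have "\<dots> = (\<integral>\<^sup>+t1. \<integral>\<^sup>+t2. \<integral>\<^sup>+t3. \<integral>\<^sup>+p. F (t1, t2, t3) p \<partial>lborel3 \<partial>lborel \<partial>lborel \<partial>lborel)"
  \<comment> \<open>At a vanishing frequency the left integrand is 0 by division by zero while the
    right one is not; these null sets are discarded.\<close>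
  proof (intro nn_integral_cong_AE AE_mp[OF AE_lborel_singleton[of 0] AE_I2] impI)
    fix t1 t2 t3 :: real assume t: "t1 \<noteq> 0" "t2 \<noteq> 0" "t3 \<noteq> 0"
    define e where "e = exp (- (t1\<^sup>2 + t2\<^sup>2 + t3\<^sup>2) / 2)"
    have s0: "sinh (u * v) / v \<ge> 0" if "u > 0" "v \<noteq> 0" for u v :: real
      using that by (cases "v > 0") (auto simp: zero_le_divide_iff mult_nonneg_nonpos mult_pos_neg less_imp_le)
    have e3: "ennreal (e * (p * q * r)) = ennreal e * (ennreal p * ennreal q * ennreal r)"
      if "p \<ge> 0" "q \<ge> 0" "r \<ge> 0" for p q r
      using that by (simp add: ennreal_mult e_def)
    \<comment> \<open>The square of \<open>t1 * t2 * t3\<close> is split as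
      \<open>(t1 * t2) * (t1 * t3) * (t2 * t3)\<close>, one factor for each sinh. Since sinh is odd
      and increasing, every quotient is nonnegative whatever the signs of the frequencies, so
      \<open>ennreal\<close> distributes over the product.\<close>
    have "ennreal (e * (sinh (a * t1 * t2) * sinh (b * t1 * t3) * sinh (c * t2 * t3)) / (t1\<^sup>2 * t2\<^sup>2 * t3\<^sup>2))
        = ennreal (e * (sinh (a * (t1 * t2)) / (t1 * t2) * (sinh (b * (t1 * t3)) / (t1 * t3))
            * (sinh (c * (t2 * t3)) / (t2 * t3))))"
      by (rule arg_cong[of _ _ ennreal]) (simp add: power2_eq_square mult_ac)
    also have "\<dots> = ennreal e * (ennreal (sinh (a * (t1 * t2)) / (t1 * t2)) * ennreal (sinh (b * (t1 * t3)) / (t1 * t3))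
            * ennreal (sinh (c * (t2 * t3)) / (t2 * t3)))"
      by (rule e3) (use s0 a b c t in auto)
    also have "\<dots> = ennreal e * (\<integral>\<^sup>+(x, y, z). (ennreal (exp (- (x * (t1 * t2))) / 2) * indicator {-a..a} x)
        * (ennreal (exp (- (y * (t1 * t3))) / 2) * indicator {-b..b} y)
        * (ennreal (exp (- (z * (t2 * t3))) / 2) * indicator {-c..c} z) \<partial>lborel3)"
      using t a b c by (subst nn_integral_lborel3_prod) (auto simp: sinh_divide_eq_nn_integral)
    also have "\<dots> = (\<integral>\<^sup>+p. F (t1, t2, t3) p \<partial>lborel3)"
    proof (subst nn_integral_cmult[symmetric])
      have "exp (- (t1\<^sup>2 + t2\<^sup>2 + t3\<^sup>2) / 2 - (x * t1 * t2 + y * t1 * t3 + z * t2 * t3)) / 8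
          = e * (exp (- (x * (t1 * t2))) / 2 * (exp (- (y * (t1 * t3))) / 2) * (exp (- (z * (t2 * t3))) / 2))" for x y z
        by (simp add: e_def exp_add[symmetric] algebra_simps)
      then have "ennreal (exp (- (t1\<^sup>2 + t2\<^sup>2 + t3\<^sup>2) / 2 - (x * t1 * t2 + y * t1 * t3 + z * t2 * t3)) / 8)
          = ennreal e * (ennreal (exp (- (x * (t1 * t2))) / 2) * ennreal (exp (- (y * (t1 * t3))) / 2)
            * ennreal (exp (- (z * (t2 * t3))) / 2))" for x y z
        by (simp only: e3 divide_nonneg_nonneg exp_ge_zero zero_le_numeral)
      then show "(\<integral>\<^sup>+p. ennreal e * (case p of (x, y, z) \<Rightarrow>
          (ennreal (exp (- (x * (t1 * t2))) / 2) * indicator {-a..a} x)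
          * (ennreal (exp (- (y * (t1 * t3))) / 2) * indicator {-b..b} y)
          * (ennreal (exp (- (z * (t2 * t3))) / 2) * indicator {-c..c} z)) \<partial>lborel3)
        = (\<integral>\<^sup>+p. F (t1, t2, t3) p \<partial>lborel3)"
        by (intro nn_integral_cong) (auto simp: F_def mult_ac split: split_indicator)
    qed measurable
    finally show "ennreal (exp (- (t1\<^sup>2 + t2\<^sup>2 + t3\<^sup>2) / 2)
    * (sinh (a * t1 * t2) * sinh (b * t1 * t3) * sinh (c * t2 * t3)) / (t1\<^sup>2 * t2\<^sup>2 * t3\<^sup>2))
      = (\<integral>\<^sup>+p. F (t1, t2, t3) p \<partial>lborel3)" by (simp add: e_def)
  qed
  also have "\<dots> = (\<integral>\<^sup>+t. \<integral>\<^sup>+p. F t p \<partial>lborel3 \<partial>lborel3)"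
    by (rule nn_integral_lborel3[OF Fp_m, symmetric])
  also have "\<dots> = (\<integral>\<^sup>+p. \<integral>\<^sup>+t. F t p \<partial>lborel3 \<partial>lborel3)"
    using Fubini_lborel3[OF F_m'] by (simp add: lborel_prod)
  also have "\<dots> = (\<integral>\<^sup>+x. \<integral>\<^sup>+y. \<integral>\<^sup>+z. \<integral>\<^sup>+t. F t (x, y, z) \<partial>lborel3 \<partial>lborel \<partial>lborel \<partial>lborel)"
    by (rule nn_integral_lborel3[OF Ft_m])
  also have "\<dots> = (\<integral>\<^sup>+x. \<integral>\<^sup>+y. \<integral>\<^sup>+z. ennreal (sqrt (2 * pi) ^ 3 / 8) * (ennreal (J_integrand x y z)
      * (indicator {-a..a} x * indicator {-b..b} y * indicator {-c..c} z)) \<partial>lborel \<partial>lborel \<partial>lborel)"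
  \<comment> \<open>Off the two faces the determinant is strictly positive, as required by the
    Gaussian integral; this covers \<open>Delta (- 1) a b c = 0\<close>.\<close>
  proof (intro nn_integral_cong_AE[OF AE_mp[OF AE_lborel_singleton[of a] AE_mp[OF AE_lborel_singleton[of "- a"] AE_I2]]]
      impI nn_integral_cong)
    fix x y z :: real assume x: "x \<noteq> a" "x \<noteq> - a"
    show "(\<integral>\<^sup>+t. F t (x, y, z) \<partial>lborel3) = ennreal (sqrt (2 * pi) ^ 3 / 8) * (ennreal (J_integrand x y z)
      * (indicator {-a..a} x * indicator {-b..b} y * indicator {-c..c} z))"
    proof (cases "x \<in> {-a..a} \<and> y \<in> {-b..b} \<and> z \<in> {-c..c}")
      case True
      then have pos: "gram_det x y z > 0" and z: "\<bar>z\<bar> < 1"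
        using gram_det_pos[OF b c(1) D, of x y z] x c by auto
      have "(\<integral>\<^sup>+t. F t (x, y, z) \<partial>lborel3)
          = (\<integral>\<^sup>+t. ennreal (1 / 8) * (case t of (t1, t2, t3) \<Rightarrow> ennreal (exp (- (t1\<^sup>2 + t2\<^sup>2 + t3\<^sup>2) / 2
              - (x * t1 * t2 + y * t1 * t3 + z * t2 * t3)))) \<partial>lborel3)"
        using True by (intro nn_integral_cong) (auto simp: F_def ennreal_mult[symmetric] split: prod.splits)
      also have "\<dots> = ennreal (1 / 8) * ennreal (sqrt (2 * pi) ^ 3 / sqrt (gram_det x y z))"
        by (subst nn_integral_cmult, measurable, subst nn_integral_gaussian3[OF pos z]) simp
      finally show ?thesis
        using True pos by (simp add: J_integrand_eq ennreal_mult[symmetric])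
    qed (auto simp: F_def split_beta split: split_indicator)
  qed
  also have "\<dots> = (\<integral>\<^sup>+p. ennreal (sqrt (2 * pi) ^ 3 / 8) * (case p of (x, y, z) \<Rightarrow> ennreal (J_integrand x y z)
      * (indicator {-a..a} x * indicator {-b..b} y * indicator {-c..c} z)) \<partial>lborel3)"
    by (subst nn_integral_lborel3) (auto simp: case_prod_beta')
  also have "\<dots> = ennreal (sqrt (2 * pi) ^ 3 / 8) * (\<integral>\<^sup>+(x, y, z). ennreal (J_integrand x y z)
      * (indicator {-a..a} x * indicator {-b..b} y * indicator {-c..c} z) \<partial>lborel3)"
    by (rule nn_integral_cmult) measurable
  also have "\<dots> = ennreal (sqrt (2 * pi) ^ 3 / 8) * ennreal 4 * (\<integral>\<^sup>+(x, y, z). ennreal (J_integrand x y z)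
      * indicator ({0..a} \<times> {0..b} \<times> {-c..c}) (x, y, z) \<partial>lborel3)"
    using a b by (subst nn_integral_J_integrand_symmetric) (auto simp: mult.assoc)
  also have "ennreal (sqrt (2 * pi) ^ 3 / 8) * ennreal 4 = ennreal (sqrt (2 * pi) ^ 3 / 2)"
    by (subst ennreal_mult[symmetric]) auto
  finally show ?thesis .
qed

section \<open>The difference between the two sign classes\<close>

text \<open>Two correlations change sign when one of the three vectors is replaced by its negative.
  The cosh factors are even, and the two signs cancel in the sinh product.\<close>

lemma cos_kernel_neg:
  "cos_kernel (- p) (- q) r = cos_kernel p q r"
  "cos_kernel (- p) q (- r) = cos_kernel p q r"
  "cos_kernel p (- q) (- r) = cos_kernel p q r"
  by (simp_all add: cos_kernel_def fun_eq_iff Let_def)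

lemma cos_kernel_pos_sign:
  assumes "p * q * r > 0"
  shows "cos_kernel p q r = cos_kernel (\<bar>p\<bar>) (\<bar>q\<bar>) (\<bar>r\<bar>)"
  using assms by (auto simp: zero_less_mult_iff mult_less_0_iff cos_kernel_neg)

text \<open>Every sign pattern with negative product reduces, by flipping pairs, to the one with the
  minus on the third entry, which is the normal form used in \<open>G (- 1) a b c\<close>.\<close>

lemma cos_kernel_neg_sign:
  assumes "p * q * r < 0"
  shows "cos_kernel p q r = cos_kernel (\<bar>p\<bar>) (\<bar>q\<bar>) (- \<bar>r\<bar>)"
  using assms cos_kernel_neg[of "-p" "-q" "-r"]
  by (auto simp: zero_less_mult_iff mult_less_0_iff cos_kernel_neg)

text \<open>Stated as a sum so that the integrals can be compared in \<open>ennreal\<close> without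
  subtraction.\<close>

lemma cos_kernel_diff:
  "cos_kernel a b c t1 t2 t3 = cos_kernel a b (- c) t1 t2 t3
    + 2 * (exp (- (t1\<^sup>2 + t2\<^sup>2 + t3\<^sup>2) / 2) * (sinh (a * t1 * t2) * sinh (b * t1 * t3) * sinh (c * t2 * t3)))"
proof -
  have "exp (- (t1\<^sup>2 + t2\<^sup>2 + t3\<^sup>2) / 2) = exp (- t1\<^sup>2 / 2) * exp (- t2\<^sup>2 / 2) * exp (- t3\<^sup>2 / 2)"
    by (simp add: exp_add[symmetric] field_simps)
  then show ?thesis
    by (simp add: cos_kernel_def Let_def algebra_simps)
qed

section \<open>Spherical means as kernel integrals, and their comparison\<close>

lemma I3_nonneg: "I3 n1 n2 n3 \<ge> 0"
  by (simp add: I3_def)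

text \<open>The measure is carried by the sphere, where Cauchy-Schwarz bounds the integrand. The
  resulting finiteness is what later makes the box integral finite.\<close>

lemma ennreal_I3:
  "ennreal (I3 n1 n2 n3) = (\<integral>\<^sup>+u. ennreal (\<bar>u \<bullet> n1\<bar> * \<bar>u \<bullet> n2\<bar> * \<bar>u \<bullet> n3\<bar>) \<partial>uniform_sphere)"
proof -
  interpret prob_space uniform_sphere by (rule prob_space_uniform_sphere)
  have m[measurable]: "(\<lambda>u. \<bar>u \<bullet> n1\<bar> * \<bar>u \<bullet> n2\<bar> * \<bar>u \<bullet> n3\<bar>) \<in> borel_measurable uniform_sphere"
    by (simp add: measurable_cong_sets[OF sets_uniform_sphere refl])
  have "AE u in uniform_sphere. u \<in> sphere 0 1"
    by (subst AE_in_set_eq_1) (auto simp: sets_uniform_sphere emeasure_uniform_sphere_sphere measure_def)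
  then have "AE u in uniform_sphere. norm (\<bar>u \<bullet> n1\<bar> * \<bar>u \<bullet> n2\<bar> * \<bar>u \<bullet> n3\<bar>) \<le> norm n1 * norm n2 * norm n3"
  proof (rule AE_mp, intro AE_I2 impI)
    fix u :: "real^3" assume "u \<in> sphere 0 1"
    then have "\<bar>u \<bullet> n\<bar> \<le> norm n" for n
      using Cauchy_Schwarz_ineq2[of u n] by simp
    then show "norm (\<bar>u \<bullet> n1\<bar> * \<bar>u \<bullet> n2\<bar> * \<bar>u \<bullet> n3\<bar>) \<le> norm n1 * norm n2 * norm n3"
      by (simp add: abs_mult mult_mono)
  qed
  then have "integrable uniform_sphere (\<lambda>u. \<bar>u \<bullet> n1\<bar> * \<bar>u \<bullet> n2\<bar> * \<bar>u \<bullet> n3\<bar>)"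
    by (rule integrable_const_bound) (rule m)
  then show ?thesis
    unfolding I3_def by (subst nn_integral_eq_integral) auto
qed

lemma ennreal_I3_kernel:
  assumes n: "n1 \<in> sphere 0 1" "n2 \<in> sphere 0 1" "n3 \<in> sphere 0 1"
  shows "ennreal (32 * pi ^ 4 * I3 n1 n2 n3) = (\<integral>\<^sup>+(t1, t2, t3). ennreal (sqrt (2 * pi) ^ 3
          * cos_kernel (n1 \<bullet> n2) (n1 \<bullet> n3) (n2 \<bullet> n3) t1 t2 t3 / (t1\<^sup>2 * t2\<^sup>2 * t3\<^sup>2)) \<partial>lborel3)"
proof -
  define S where "S = (\<integral>\<^sup>+x. ennreal (\<bar>x \<bullet> n1\<bar> * \<bar>x \<bullet> n2\<bar> * \<bar>x \<bullet> n3\<bar>) * ennreal (exp (- (norm x)\<^sup>2 / 2)) \<partial>lborel)"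
  have "ennreal (I3 n1 n2 n3) = S / ennreal (32 * pi)"
    unfolding ennreal_I3 S_def
    by (rule nn_integral_uniform_sphere)
       (auto simp: ennreal_mult[symmetric] abs_mult power3_eq_cube mult_ac)
  then have "ennreal (32 * pi) * ennreal (I3 n1 n2 n3) = S"
    by (simp add: ennreal_times_divide mult_divide_eq_ennreal mult.commute[of _ S])
  then have "ennreal (pi ^ 3) * (ennreal (32 * pi) * ennreal (I3 n1 n2 n3)) = ennreal (pi ^ 3) * S"
    by simp
  moreover have "ennreal (pi ^ 3) * (ennreal (32 * pi) * ennreal (I3 n1 n2 n3)) = ennreal (32 * pi ^ 4 * I3 n1 n2 n3)"
    by (simp add: ennreal_mult[symmetric] I3_nonneg power_numeral_reduce mult_ac)
  ultimately show ?thesis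
    using nn_integral_gaussian_abs_prod[of n1 n2 n3] n by (simp only: S_def) simp
qed

text \<open>The kernel formula involves the vectors only through their inner products. This is what
  makes \<open>J\<close> well defined.\<close>

lemma I3_cong_gram:
  assumes "n1 \<in> sphere 0 1" "n2 \<in> sphere 0 1" "n3 \<in> sphere 0 1"
    and "m1 \<in> sphere 0 1" "m2 \<in> sphere 0 1" "m3 \<in> sphere 0 1"
    and "n1 \<bullet> n2 = m1 \<bullet> m2" "n1 \<bullet> n3 = m1 \<bullet> m3" "n2 \<bullet> n3 = m2 \<bullet> m3"
  shows "I3 n1 n2 n3 = I3 m1 m2 m3"
proof -
  have "ennreal (32 * pi ^ 4 * I3 n1 n2 n3) = ennreal (32 * pi ^ 4 * I3 m1 m2 m3)"
    using assms by (simp only: ennreal_I3_kernel)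
  then show ?thesis by (simp add: I3_nonneg)
qed

lemma sinh_prod_nonneg:
  fixes u v w :: real
  assumes "u * v * w \<ge> 0"
  shows "sinh u * sinh v * sinh w \<ge> 0"
  using assms by (auto simp: zero_le_mult_iff mult_le_0_iff)

abbreviation J_box_integral :: "real \<Rightarrow> real \<Rightarrow> real \<Rightarrow> ennreal" where
  "J_box_integral a b c \<equiv> (\<integral>\<^sup>+(x, y, z). ennreal (J_integrand x y z) * indicator ({0..a} \<times> {0..b} \<times> {-c..c}) (x, y, z) \<partial>lborel3)"

lemma I3_sign_difference:
  assumes n: "n1 \<in> sphere 0 1" "n2 \<in> sphere 0 1" "n3 \<in> sphere 0 1"
    and m: "m1 \<in> sphere 0 1" "m2 \<in> sphere 0 1" "m3 \<in> sphere 0 1"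
    and n_abs: "\<bar>n1 \<bullet> n2\<bar> = a" "\<bar>n1 \<bullet> n3\<bar> = b" "\<bar>n2 \<bullet> n3\<bar> = c"
    and m_abs: "\<bar>m1 \<bullet> m2\<bar> = a" "\<bar>m1 \<bullet> m3\<bar> = b" "\<bar>m2 \<bullet> m3\<bar> = c"
    and n_sgn: "(n1 \<bullet> n2) * (n1 \<bullet> n3) * (n2 \<bullet> n3) > 0"
    and m_sgn: "(m1 \<bullet> m2) * (m1 \<bullet> m3) * (m2 \<bullet> m3) < 0"
    and abc: "0 < a" "0 < b" "0 < c" "c < 1" and D: "Delta (- 1) a b c \<ge> 0"
  shows "ennreal (4 * pi * I3 n1 n2 n3) = ennreal (4 * pi * I3 m1 m2 m3) + J_box_integral a b c"
proof -
  define K where "K = sqrt (2 * pi) ^ 3"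
  have "K * K = (sqrt (2 * pi) * sqrt (2 * pi)) ^ 3"
    by (simp only: K_def power_mult_distrib)
  then have K: "K > 0" "K * K = 8 * pi ^ 3"
    by (simp_all add: K_def power_mult_distrib)
  define s where "s = (\<lambda>t1 t2 t3. exp (- (t1\<^sup>2 + t2\<^sup>2 + t3\<^sup>2) / 2)
      * (sinh (a * t1 * t2) * sinh (b * t1 * t3) * sinh (c * t2 * t3)) / (t1\<^sup>2 * t2\<^sup>2 * t3\<^sup>2))"
  have s0: "s t1 t2 t3 \<ge> 0" for t1 t2 t3
  proof -
    \<comment> \<open>Each frequency occurs in two of the three arguments, so their product is a
      square times \<open>a * b * c\<close>.\<close>
    have "(a * t1 * t2) * (b * t1 * t3) * (c * t2 * t3) = a * b * c * (t1 * t2 * t3)\<^sup>2"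
      by (simp add: power2_eq_square mult_ac)
    also have "\<dots> \<ge> 0" using abc by simp
    finally have "sinh (a * t1 * t2) * sinh (b * t1 * t3) * sinh (c * t2 * t3) \<ge> 0"
      by (rule sinh_prod_nonneg)
    then show ?thesis by (simp add: s_def)
  qed
  \<comment> \<open>The kernel of the negative class is the Gaussian integral of a nonnegative
    product for the realizing triple \<open>m1\<close>, \<open>m2\<close>, \<open>m3\<close>. With
    \<open>s0\<close> this allows \<open>ennreal\<close> to be split over the sum.\<close>
  have W0: "K * cos_kernel a b (- c) t1 t2 t3 \<ge> 0" for t1 t2 t3
  proof -
    have "K * cos_kernel (m1 \<bullet> m2) (m1 \<bullet> m3) (m2 \<bullet> m3) t1 t2 t3 \<ge> 0"
      unfolding K_def
      by (subst has_bochner_integral_integral_eq[OF gaussian_cos_kernel, symmetric])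
         (use m in \<open>auto intro!: integral_nonneg_AE\<close>)
    then show ?thesis using m_sgn m_abs by (simp add: cos_kernel_neg_sign)
  qed
  have [measurable]: "(\<lambda>(t1, t2, t3). ennreal (K * cos_kernel a b (- c) t1 t2 t3 / (t1\<^sup>2 * t2\<^sup>2 * t3\<^sup>2))) \<in> borel_measurable lborel3"
    "(\<lambda>(t1, t2, t3). ennreal (s t1 t2 t3)) \<in> borel_measurable lborel3"
    unfolding cos_kernel_def Let_def s_def cosh_field_def case_prod_beta' by measurable
  have "ennreal (32 * pi ^ 4 * I3 n1 n2 n3)
      = (\<integral>\<^sup>+t. (case t of (t1, t2, t3) \<Rightarrow> ennreal (K * cos_kernel a b (- c) t1 t2 t3 / (t1\<^sup>2 * t2\<^sup>2 * t3\<^sup>2)))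
          + ennreal (2 * K) * (case t of (t1, t2, t3) \<Rightarrow> ennreal (s t1 t2 t3)) \<partial>lborel3)"
    unfolding ennreal_I3_kernel[OF n] cos_kernel_pos_sign[OF n_sgn] n_abs
  proof (intro nn_integral_cong, clarify)
    fix t1 t2 t3 :: real
    have "sqrt (2 * pi) ^ 3 * cos_kernel a b c t1 t2 t3 / (t1\<^sup>2 * t2\<^sup>2 * t3\<^sup>2)
        = K * cos_kernel a b (- c) t1 t2 t3 / (t1\<^sup>2 * t2\<^sup>2 * t3\<^sup>2) + 2 * K * s t1 t2 t3"
      by (simp add: cos_kernel_diff[of a b c] s_def K_def distrib_left add_divide_distrib)
    then show "ennreal (sqrt (2 * pi) ^ 3 * cos_kernel a b c t1 t2 t3 / (t1\<^sup>2 * t2\<^sup>2 * t3\<^sup>2))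
        = ennreal (K * cos_kernel a b (- c) t1 t2 t3 / (t1\<^sup>2 * t2\<^sup>2 * t3\<^sup>2)) + ennreal (2 * K) * ennreal (s t1 t2 t3)"
      using s0[of t1 t2 t3] W0[of t1 t2 t3] K(1) by (simp add: ennreal_mult[symmetric] ennreal_plus[symmetric] del: ennreal_plus)
  qed
  also have "\<dots> = (\<integral>\<^sup>+(t1, t2, t3). ennreal (K * cos_kernel a b (- c) t1 t2 t3 / (t1\<^sup>2 * t2\<^sup>2 * t3\<^sup>2)) \<partial>lborel3)
      + ennreal (2 * K) * (\<integral>\<^sup>+(t1, t2, t3). ennreal (s t1 t2 t3) \<partial>lborel3)"
    by (subst nn_integral_add, measurable, subst nn_integral_cmult, measurable)
  also have "(\<integral>\<^sup>+(t1, t2, t3). ennreal (K * cos_kernel a b (- c) t1 t2 t3 / (t1\<^sup>2 * t2\<^sup>2 * t3\<^sup>2)) \<partial>lborel3)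
      = ennreal (32 * pi ^ 4 * I3 m1 m2 m3)"
    unfolding ennreal_I3_kernel[OF m] cos_kernel_neg_sign[OF m_sgn] m_abs K_def ..
  also have "(\<integral>\<^sup>+(t1, t2, t3). ennreal (s t1 t2 t3) \<partial>lborel3) = ennreal (K / 2) * J_box_integral a b c"
    unfolding s_def K_def by (rule nn_integral_sinh_kernel[OF abc D])
  \<comment> \<open>Here \<open>2 * K * (K / 2) = K * K = 8 * pi ^ 3\<close>, and
    \<open>32 * pi ^ 4\<close> is \<open>8 * pi ^ 3\<close> times \<open>4 * pi\<close>.\<close>
  also have "ennreal (2 * K) * (ennreal (K / 2) * J_box_integral a b c) = ennreal (8 * pi ^ 3) * J_box_integral a b c"
    using K by (simp add: mult.assoc[symmetric] ennreal_mult[symmetric])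
  finally have "ennreal (8 * pi ^ 3) * ennreal (4 * pi * I3 n1 n2 n3)
      = ennreal (8 * pi ^ 3) * (ennreal (4 * pi * I3 m1 m2 m3) + J_box_integral a b c)"
    by (simp add: distrib_left ennreal_mult[symmetric] I3_nonneg power_numeral_reduce mult_ac)
  then show ?thesis
    by (subst (asm) ennreal_mult_cancel_left) auto
qed

section \<open>Bounds for the determinant and the passage to real integrals\<close>

lemma gram_det_ge_Delta:
  assumes "\<bar>x\<bar> \<le> a" "\<bar>y\<bar> \<le> b" "\<bar>z\<bar> \<le> c"
  shows "gram_det x y z \<ge> Delta (- 1) a b c"
proof -
  have "x\<^sup>2 \<le> a\<^sup>2" "y\<^sup>2 \<le> b\<^sup>2" "z\<^sup>2 \<le> c\<^sup>2"
    using assms power_mono[of "\<bar>x\<bar>" a 2] power_mono[of "\<bar>y\<bar>" b 2] power_mono[of "\<bar>z\<bar>" c 2] by auto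
  moreover have "\<bar>x * y * z\<bar> \<le> a * b * c"
    unfolding abs_mult using assms by (intro mult_mono mult_nonneg_nonneg) auto
  then have "2 * x * y * z \<ge> - (2 * a * b * c)" by (simp add: mult.assoc abs_le_iff)
  ultimately show ?thesis by (simp add: gram_det_def Delta_def)
qed

lemma gram_det_le_1:
  assumes "\<bar>z\<bar> \<le> 1"
  shows "gram_det x y z \<le> 1"
proof -
  have "gram_det x y z = 1 - (x - y * z)\<^sup>2 - y\<^sup>2 * (1 - z\<^sup>2) - z\<^sup>2"
    by (simp add: gram_det_def power2_eq_square algebra_simps)
  moreover have "y\<^sup>2 * (1 - z\<^sup>2) \<ge> 0"
    using assms by (simp add: abs_square_le_1)
  ultimately show ?thesis
    using zero_le_power2[of "x - y * z"] zero_le_power2[of z] by linarith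
qed

lemma J_box_integral_ge:
  assumes abc: "0 < a" "0 < b" "0 < c" "c < 1" and D: "Delta (- 1) a b c \<ge> 0"
  shows "J_box_integral a b c \<ge> ennreal (2 * a * b * c)"
proof -
  have "ennreal (2 * a * b * c) = ennreal a * ennreal b * ennreal (2 * c)"
    using abc by (simp add: ennreal_mult[symmetric] mult_ac)
  also have "\<dots> = (\<integral>\<^sup>+(x, y, z). indicator {0..a} x * indicator {0..b} y * indicator {-c..c} z \<partial>lborel3)"
    using abc by (subst nn_integral_lborel3_prod) auto
  also have "\<dots> = (\<integral>\<^sup>+x. \<integral>\<^sup>+y. \<integral>\<^sup>+z. indicator {0..a} x * indicator {0..b} y * indicator {-c..c} z \<partial>lborel \<partial>lborel \<partial>lborel)"
    by (rule nn_integral_lborel3_curried) (unfold case_prod_beta', measurable)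
  also have "\<dots> \<le> (\<integral>\<^sup>+x. \<integral>\<^sup>+y. \<integral>\<^sup>+z. ennreal (J_integrand x y z)
      * indicator ({0..a} \<times> {0..b} \<times> {-c..c}) (x, y, z) \<partial>lborel \<partial>lborel \<partial>lborel)"
  \<comment> \<open>Where the determinant vanishes, \<open>J_integrand\<close> is 0 by division by
    zero and the bound by 1 fails; this can only happen on the null face
    \<open>x = a\<close>.\<close>
  proof (intro nn_integral_mono_AE[OF AE_mp[OF AE_lborel_singleton[of a] AE_I2]] impI nn_integral_mono)
    fix x y z :: real assume x: "x \<noteq> a"
    show "indicator {0..a} x * indicator {0..b} y * indicator {-c..c} z
      \<le> ennreal (J_integrand x y z) * indicator ({0..a} \<times> {0..b} \<times> {-c..c}) (x, y, z)"
    proof (cases "x \<in> {0..a} \<and> y \<in> {0..b} \<and> z \<in> {-c..c}")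
      case True
      then have "gram_det x y z > 0" "gram_det x y z \<le> 1"
        using x abc by (auto intro!: gram_det_pos[OF _ _ D] gram_det_le_1)
      then have "1 \<le> J_integrand x y z"
        by (simp add: J_integrand_eq le_divide_eq_1)
      then show ?thesis using True by simp
    qed (auto split: split_indicator)
  qed
  also have "\<dots> = J_box_integral a b c"
    by (rule nn_integral_lborel3_curried[symmetric]) (unfold case_prod_beta', measurable)
  finally show ?thesis .
qed

text \<open>A finite nonnegative integral of a nonnegative function gives Bochner integrability on
  the box, and then Fubini identifies its value with the iterated real integrals.\<close>

lemma J_box_integral_iterated:
  assumes abc: "0 < a" "0 < b" "0 < c" and D: "Delta (- 1) a b c \<ge> 0"
    and fin: "J_box_integral a b c < \<infinity>"
  shows "set_integrable lborel ({0..a} \<times> {0..b} \<times> {-c..c}) (\<lambda>(x, y, z). J_integrand x y z)"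
    and "J_box_integral a b c
      = ennreal (LBINT x=0..a. (LBINT y=0..b. (LBINT z=-c..c. J_integrand x y z)))"
    and "(LBINT x=0..a. (LBINT y=0..b. (LBINT z=-c..c. J_integrand x y z))) \<ge> 0"
proof -
  define f where "f = (\<lambda>p. indicator ({0..a} \<times> {0..b} \<times> {-c..c}) p *\<^sub>R (case p of (x, y, z) \<Rightarrow> J_integrand x y z))"
  have f_m: "f \<in> borel_measurable lborel3"
    unfolding f_def case_prod_beta' by measurable
  \<comment> \<open>\<open>sqrt\<close> of a negative number is negative in HOL, so the sign of the
    integrand depends on the lower bound for the determinant; the faces are included here, with
    value 0 where the determinant is 0.\<close>
  have f0: "f p \<ge> 0" for p
  proof (cases p)
    case (fields x y z)
    have "gram_det x y z \<ge> 0" if "x \<in> {0..a}" "y \<in> {0..b}" "z \<in> {-c..c}"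
      using that D gram_det_ge_Delta[of x a y b z c] by (auto simp: abs_le_iff)
    then show ?thesis
      by (auto simp: f_def fields J_integrand_eq split: split_indicator)
  qed
  have f_nn: "(\<integral>\<^sup>+p. ennreal (f p) \<partial>lborel3) = J_box_integral a b c"
    by (intro nn_integral_cong) (auto simp: f_def indicator_def)
  have f_int: "integrable lborel3 f"
    using fin by (intro integrableI_nonneg f_m) (auto simp: f0 f_nn)
  then show int: "set_integrable lborel ({0..a} \<times> {0..b} \<times> {-c..c}) (\<lambda>(x, y, z). J_integrand x y z)"
    by (simp add: set_integrable_def f_def lborel_prod)
  have box: "J_box_integral a b c = ennreal (\<integral>p. f p \<partial>lborel3)"
    using nn_integral_eq_integral[OF f_int] f0 f_nn by simp
  have sf: "sigma_finite_measure (lborel \<Otimes>\<^sub>M lborel :: (real \<times> real) measure)"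
    by (simp add: lborel_prod sigma_finite_lborel)
  interpret P: pair_sigma_finite lborel "lborel \<Otimes>\<^sub>M lborel :: (real \<times> real) measure"
    by (rule pair_sigma_finite.intro[OF sigma_finite_lborel sf])
  have "(\<integral>p. f p \<partial>lborel3) = (\<integral>x. (\<integral>s. f (x, s) \<partial>(lborel \<Otimes>\<^sub>M lborel)) \<partial>lborel)"
    by (rule P.integral_fst'[OF f_int, symmetric])
  also have "\<dots> = (\<integral>x. (\<integral>y. (\<integral>z. f (x, y, z) \<partial>lborel) \<partial>lborel) \<partial>lborel)"
  proof (rule integral_cong_AE)
    note f_m[measurable]
    show "(\<lambda>x. \<integral>s. f (x, s) \<partial>(lborel \<Otimes>\<^sub>M lborel)) \<in> borel_measurable lborel"
      by (rule sigma_finite_measure.borel_measurable_lebesgue_integral[OF sf]) simp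
    show "(\<lambda>x. \<integral>y. (\<integral>z. f (x, y, z) \<partial>lborel) \<partial>lborel) \<in> borel_measurable lborel"
      by measurable
    \<comment> \<open>Integrability of the sections is guaranteed only for almost every
      \<open>x\<close>, hence the equality of the inner integrals only almost everywhere.\<close>
    show "AE x in lborel. (\<integral>s. f (x, s) \<partial>(lborel \<Otimes>\<^sub>M lborel)) = (\<integral>y. (\<integral>z. f (x, y, z) \<partial>lborel) \<partial>lborel)"
      using P.AE_integrable_fst'[OF f_int] by eventually_elim (rule lborel_pair.integral_fst'[symmetric])
  qed
  also have "\<dots> = (LBINT x=0..a. (LBINT y=0..b. (LBINT z=-c..c. J_integrand x y z)))"
  proof -
    have ind: "f (x, y, z) = indicator {0..a} x * (indicator {0..b} y * (indicator {-c..c} z * J_integrand x y z))" for x y z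
      by (auto simp: f_def split: split_indicator)
    have "(LBINT x=ereal 0..ereal a. (LBINT y=ereal 0..ereal b. (LBINT z=ereal (-c)..ereal c. J_integrand x y z)))
        = (\<integral>x. (\<integral>y. (\<integral>z. f (x, y, z) \<partial>lborel) \<partial>lborel) \<partial>lborel)"
      using abc by (simp add: interval_integral_Icc set_lebesgue_integral_def ind del: uminus_ereal.simps)
    then show ?thesis by (simp add: zero_ereal_def)
  qed
  finally have eq: "(\<integral>p. f p \<partial>lborel3) = (LBINT x=0..a. (LBINT y=0..b. (LBINT z=-c..c. J_integrand x y z)))" .
  show "J_box_integral a b c = ennreal (LBINT x=0..a. (LBINT y=0..b. (LBINT z=-c..c. J_integrand x y z)))"
    using box eq by simp
  show "(LBINT x=0..a. (LBINT y=0..b. (LBINT z=-c..c. J_integrand x y z))) \<ge> 0"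
    unfolding eq[symmetric] by (rule integral_nonneg_AE) (simp add: f0)
qed

section \<open>Feasibility and realizability\<close>

lemma gram_det_unit_nonneg:
  fixes n1 n2 n3 :: "'a :: real_inner"
  assumes n: "norm n1 = 1" "norm n2 = 1" "norm n3 = 1" and p: "\<bar>n1 \<bullet> n2\<bar> < 1"
  shows "gram_det (n1 \<bullet> n2) (n1 \<bullet> n3) (n2 \<bullet> n3) \<ge> 0"
proof -
  define p q r where "p = n1 \<bullet> n2" and "q = n1 \<bullet> n3" and "r = n2 \<bullet> n3"
  have inn: "n1 \<bullet> n1 = 1" "n2 \<bullet> n2 = 1" "n3 \<bullet> n3 = 1" "n1 \<bullet> n2 = p" "n2 \<bullet> n1 = p"
    "n1 \<bullet> n3 = q" "n3 \<bullet> n1 = q" "n2 \<bullet> n3 = r" "n3 \<bullet> n2 = r"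
    using n by (simp_all add: norm_eq_1 p_def q_def r_def inner_commute)
  \<comment> \<open>\<open>w\<close> is \<open>1 - p\<^sup>2\<close> times the component of
    \<open>n3\<close> orthogonal to \<open>n1\<close> and \<open>n2\<close>; its coefficients are
    cofactors of the Gram matrix.\<close>
  define w where "w = (p * r - q) *\<^sub>R n1 + (p * q - r) *\<^sub>R n2 + (1 - p\<^sup>2) *\<^sub>R n3"
  have "w \<bullet> w = (1 - p\<^sup>2) * gram_det p q r"
    by (simp add: w_def inner_add_left inner_add_right inn gram_det_def power2_eq_square algebra_simps)
  then have "(1 - p\<^sup>2) * gram_det p q r \<ge> 0" by (metis inner_ge_zero)
  moreover have "1 - p\<^sup>2 > 0" using p by (simp add: p_def abs_square_less_1)
  ultimately show ?thesis by (simp add: p_def q_def r_def zero_le_mult_iff)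
qed

text \<open>The vectors are the rows of a Cholesky factor of the Gram matrix:
  \<open>\<bar>p\<bar> < 1\<close> makes the pivot \<open>k\<close> invertible, and the nonnegative
  determinant provides the last square root.\<close>

lemma exists_unit_triple:
  assumes p: "\<bar>p\<bar> < 1" and D: "gram_det p q r \<ge> 0"
  shows "\<exists>n1\<in>sphere 0 1. \<exists>n2\<in>sphere 0 1. \<exists>n3\<in>sphere (0 :: real^3) 1. n1 \<bullet> n2 = p \<and> n1 \<bullet> n3 = q \<and> n2 \<bullet> n3 = r"
proof -
  define k where "k = sqrt (1 - p\<^sup>2)"
  have k: "k > 0" "k\<^sup>2 = 1 - p\<^sup>2" using p by (simp_all add: k_def abs_square_less_1 less_imp_le)
  define n1 n2 n3 :: "real^3" where "n1 = vector [1, 0, 0]" and "n2 = vector [p, k, 0]"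
    and "n3 = vector [q, (r - p * q) / k, sqrt (gram_det p q r) / k]"
  have "n1 \<bullet> n1 = 1" "n2 \<bullet> n2 = 1" "n1 \<bullet> n2 = p" "n1 \<bullet> n3 = q" "n2 \<bullet> n3 = r"
    using k by (simp_all add: n1_def n2_def n3_def inner_vec_def sum_3 power2_eq_square)
  moreover have "n3 \<bullet> n3 = 1"
  proof -
    have "n3 \<bullet> n3 = q\<^sup>2 + ((r - p * q)\<^sup>2 + gram_det p q r) / k\<^sup>2"
      using D by (simp add: n3_def inner_vec_def sum_3 power2_eq_square add_divide_distrib)
    also have "(r - p * q)\<^sup>2 + gram_det p q r = (1 - q\<^sup>2) * k\<^sup>2"
      unfolding k(2) gram_det_def by (simp add: power2_eq_square algebra_simps)
    finally show ?thesis using k(1) by simp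
  qed
  ultimately show ?thesis
    by (intro bexI[of _ n1] bexI[of _ n2] bexI[of _ n3]) (auto simp: norm_eq_1)
qed

lemma pos_semidef_G:
  "pos_semidef (G s a b c) \<longleftrightarrow> (\<forall>x y z. 0 \<le> x\<^sup>2 + y\<^sup>2 + z\<^sup>2 + 2 * a * x * y + 2 * b * x * z + 2 * (s * c) * y * z)"
proof -
  have tr: "transpose (G s a b c) = G s a b c"
    by (simp add: vec_eq_iff forall_3 transpose_def G_def)
  have quad: "v \<bullet> (G s a b c *v v) = (v $ 1)\<^sup>2 + (v $ 2)\<^sup>2 + (v $ 3)\<^sup>2 + 2 * a * v $ 1 * v $ 2
      + 2 * b * v $ 1 * v $ 3 + 2 * (s * c) * v $ 2 * v $ 3" for v
    by (simp add: inner_vec_def matrix_vector_mult_def sum_3 G_def power2_eq_square algebra_simps)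
  show ?thesis
  proof
    assume *: "pos_semidef (G s a b c)"
    show "\<forall>x y z. 0 \<le> x\<^sup>2 + y\<^sup>2 + z\<^sup>2 + 2 * a * x * y + 2 * b * x * z + 2 * (s * c) * y * z"
    proof (intro allI)
      fix x y z :: real
      have "0 \<le> vector [x, y, z] \<bullet> (G s a b c *v vector [x, y, z])"
        using * by (simp add: pos_semidef_def)
      then show "0 \<le> x\<^sup>2 + y\<^sup>2 + z\<^sup>2 + 2 * a * x * y + 2 * b * x * z + 2 * (s * c) * y * z"
        by (simp add: quad)
    qed
  qed (simp add: pos_semidef_def tr quad)
qed

text \<open>Forward, the quadratic form is tested at a vector of cofactors, the coefficients of
  \<open>w\<close> in \<open>gram_det_unit_nonneg\<close>. Backward, a realizing triple turns the
  quadratic form into a squared norm.\<close>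

lemma feasible_iff_gram_det:
  assumes a: "\<bar>a\<bar> < 1"
  shows "feasible s a b c \<longleftrightarrow> gram_det a b (s * c) \<ge> 0"
proof
  define r where "r = s * c"
  assume "feasible s a b c"
  then have "0 \<le> (a * r - b)\<^sup>2 + (a * b - r)\<^sup>2 + (1 - a\<^sup>2)\<^sup>2 + 2 * a * (a * r - b) * (a * b - r)
      + 2 * b * (a * r - b) * (1 - a\<^sup>2) + 2 * r * (a * b - r) * (1 - a\<^sup>2)"
    unfolding feasible_def pos_semidef_G r_def by blast
  also have "\<dots> = (1 - a\<^sup>2) * gram_det a b r"
    by (simp add: gram_det_def power2_eq_square algebra_simps)
  finally have "0 \<le> (1 - a\<^sup>2) * gram_det a b r" .
  moreover have "1 - a\<^sup>2 > 0" using a by (simp add: abs_square_less_1)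
  ultimately show "gram_det a b (s * c) \<ge> 0"
    by (simp add: r_def zero_le_mult_iff)
next
  assume "gram_det a b (s * c) \<ge> 0"
  from exists_unit_triple[OF a this] obtain n1 n2 n3 :: "real^3"
    where n: "n1 \<in> sphere 0 1" "n2 \<in> sphere 0 1" "n3 \<in> sphere 0 1" "n1 \<bullet> n2 = a" "n1 \<bullet> n3 = b" "n2 \<bullet> n3 = s * c"
    by blast
  have inn: "n1 \<bullet> n1 = 1" "n2 \<bullet> n2 = 1" "n3 \<bullet> n3 = 1" "n2 \<bullet> n1 = a" "n3 \<bullet> n1 = b" "n3 \<bullet> n2 = s * c"
    using n by (simp_all add: norm_eq_1 inner_commute)
  have "x\<^sup>2 + y\<^sup>2 + z\<^sup>2 + 2 * a * x * y + 2 * b * x * z + 2 * (s * c) * y * z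
      = (x *\<^sub>R n1 + y *\<^sub>R n2 + z *\<^sub>R n3) \<bullet> (x *\<^sub>R n1 + y *\<^sub>R n2 + z *\<^sub>R n3)" for x y z
    by (simp add: inner_add_left inner_add_right inn n power2_eq_square algebra_simps)
  then show "feasible s a b c" by (simp add: feasible_def pos_semidef_G)
qed

lemma gram_eq_G_iff:
  assumes "n1 \<in> sphere 0 1" "n2 \<in> sphere 0 1" "n3 \<in> sphere 0 1"
  shows "gram n1 n2 n3 = G s a b c \<longleftrightarrow> n1 \<bullet> n2 = a \<and> n1 \<bullet> n3 = b \<and> n2 \<bullet> n3 = s * c"
  using assms by (auto simp: gram_def G_def vec_eq_iff forall_3 Let_def norm_eq_1 inner_commute)

text \<open>The given triple is a witness for the description in \<open>J\<close>, and
  \<open>I3_cong_gram\<close> supplies uniqueness.\<close>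

lemma J_eq_I3:
  assumes n: "n1 \<in> sphere 0 1" "n2 \<in> sphere 0 1" "n3 \<in> sphere 0 1"
    and "n1 \<bullet> n2 = a" "n1 \<bullet> n3 = b" "n2 \<bullet> n3 = s * c"
  shows "J s a b c = I3 n1 n2 n3"
  unfolding J_def
proof (rule the_equality)
  show "\<exists>n1'\<in>sphere 0 1. \<exists>n2'\<in>sphere 0 1. \<exists>n3'\<in>sphere 0 1.
      gram n1' n2' n3' = G s a b c \<and> I3 n1 n2 n3 = I3 n1' n2' n3'"
    using assms gram_eq_G_iff[OF n] by blast
next
  fix v assume "\<exists>m1\<in>sphere 0 1. \<exists>m2\<in>sphere 0 1. \<exists>m3\<in>sphere 0 1.
      gram m1 m2 m3 = G s a b c \<and> v = I3 m1 m2 m3"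
  then obtain m1 m2 m3 :: "real^3" where m: "m1 \<in> sphere 0 1" "m2 \<in> sphere 0 1" "m3 \<in> sphere 0 1"
    and "gram m1 m2 m3 = G s a b c" "v = I3 m1 m2 m3" by blast
  then show "v = I3 n1 n2 n3"
    using assms gram_eq_G_iff[OF m] by (simp add: I3_cong_gram[OF m n])
qed

lemma I3_sign_difference_real:
  fixes a b c :: real
  defines "Q \<equiv> (LBINT x=0..a. (LBINT y=0..b. (LBINT z=-c..c. J_integrand x y z)))"
  assumes n: "n1 \<in> sphere 0 1" "n2 \<in> sphere 0 1" "n3 \<in> sphere 0 1"
    and m: "m1 \<in> sphere 0 1" "m2 \<in> sphere 0 1" "m3 \<in> sphere 0 1"
    and n_abs: "\<bar>n1 \<bullet> n2\<bar> = a" "\<bar>n1 \<bullet> n3\<bar> = b" "\<bar>n2 \<bullet> n3\<bar> = c"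
    and m_abs: "\<bar>m1 \<bullet> m2\<bar> = a" "\<bar>m1 \<bullet> m3\<bar> = b" "\<bar>m2 \<bullet> m3\<bar> = c"
    and n_sgn: "(n1 \<bullet> n2) * (n1 \<bullet> n3) * (n2 \<bullet> n3) > 0"
    and m_sgn: "(m1 \<bullet> m2) * (m1 \<bullet> m3) * (m2 \<bullet> m3) < 0"
    and abc: "0 < a" "0 < b" "0 < c" "c < 1" and D: "Delta (- 1) a b c \<ge> 0"
  shows "set_integrable lborel ({0..a} \<times> {0..b} \<times> {-c..c}) (\<lambda>(x, y, z). J_integrand x y z)"
    and "I3 n1 n2 n3 - I3 m1 m2 m3 = 1 / (4 * pi) * Q"
    and "I3 n1 n2 n3 - I3 m1 m2 m3 \<ge> a * b * c / (2 * pi)"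
    and "I3 n1 n2 n3 > I3 m1 m2 m3"
proof -
  note diff = I3_sign_difference[OF n m n_abs m_abs n_sgn m_sgn abc D]
  have fin: "J_box_integral a b c < \<infinity>"
  proof (rule ccontr)
    assume "\<not> J_box_integral a b c < \<infinity>"
    then have "ennreal (4 * pi * I3 n1 n2 n3) = \<infinity>" using diff by (simp add: less_top[symmetric])
    then show False by simp
  qed
  note box = J_box_integral_iterated[OF abc(1-3) D fin, folded Q_def]
  show "set_integrable lborel ({0..a} \<times> {0..b} \<times> {-c..c}) (\<lambda>(x, y, z). J_integrand x y z)"
    by (rule box(1))
  have "ennreal (4 * pi * I3 n1 n2 n3) = ennreal (4 * pi * I3 m1 m2 m3 + Q)"
    using diff box(2,3) by (simp add: I3_nonneg)
  then have "4 * pi * I3 n1 n2 n3 = 4 * pi * I3 m1 m2 m3 + Q"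
    using box(3) by (subst (asm) ennreal_inj) (auto simp: I3_nonneg)
  then show eq: "I3 n1 n2 n3 - I3 m1 m2 m3 = 1 / (4 * pi) * Q"
    by (simp add: field_simps)
  have Q: "2 * a * b * c \<le> Q"
    using J_box_integral_ge[OF abc D] box(2,3) by simp
  then show "I3 n1 n2 n3 - I3 m1 m2 m3 \<ge> a * b * c / (2 * pi)"
    unfolding eq by (simp add: field_simps)
  have "a * b * c > 0" using abc by simp
  then have "Q > 0" using Q by linarith
  then have "1 / (4 * pi) * Q > 0" by simp
  then show "I3 n1 n2 n3 > I3 m1 m2 m3" using eq by linarith
qed

section \<open>Recovering the triangle sign\<close>

lemma gram_det_sign:
  assumes "\<bar>p\<bar> = a" "\<bar>q\<bar> = b" "\<bar>r\<bar> = c" "p * q * r < 0"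
  shows "gram_det p q r = Delta (- 1) a b c"
proof -
  have "p * q * r = - (a * b * c)"
    using assms(4) abs_of_neg[OF assms(4)] by (simp add: abs_mult flip: assms(1-3))
  moreover have "p\<^sup>2 = a\<^sup>2" "q\<^sup>2 = b\<^sup>2" "r\<^sup>2 = c\<^sup>2" by (simp_all flip: assms(1-3))
  ultimately show ?thesis by (simp add: gram_det_def Delta_def mult.assoc)
qed

text \<open>The negative triple itself witnesses \<open>Delta_- \<ge> 0\<close>: this number is its
  Gram determinant. Hence the comparison of the two classes applies.\<close>

lemma triangle_sign_determined:
  assumes n: "n1 \<in> sphere 0 1" "n2 \<in> sphere 0 1" "n3 \<in> sphere 0 1"
    and m: "m1 \<in> sphere 0 1" "m2 \<in> sphere 0 1" "m3 \<in> sphere 0 1"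
    and abs: "\<bar>n1 \<bullet> n2\<bar> = \<bar>m1 \<bullet> m2\<bar>" "\<bar>n1 \<bullet> n3\<bar> = \<bar>m1 \<bullet> m3\<bar>" "\<bar>n2 \<bullet> n3\<bar> = \<bar>m2 \<bullet> m3\<bar>"
    and range: "\<bar>m1 \<bullet> m2\<bar> \<in> {0<..<1}" "\<bar>m1 \<bullet> m3\<bar> \<in> {0<..<1}" "\<bar>m2 \<bullet> m3\<bar> \<in> {0<..<1}"
    and n_sgn: "(n1 \<bullet> n2) * (n1 \<bullet> n3) * (n2 \<bullet> n3) > 0"
    and m_sgn: "(m1 \<bullet> m2) * (m1 \<bullet> m3) * (m2 \<bullet> m3) < 0"
  shows "I3 n1 n2 n3 > I3 m1 m2 m3"
proof -
  have "Delta (- 1) \<bar>m1 \<bullet> m2\<bar> \<bar>m1 \<bullet> m3\<bar> \<bar>m2 \<bullet> m3\<bar> \<ge> 0"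
    using gram_det_unit_nonneg[of m1 m2 m3] gram_det_sign[OF refl refl refl m_sgn] m range by simp
  then show ?thesis
    using range by (intro I3_sign_difference_real(4)[OF n m abs refl refl refl n_sgn m_sgn]) auto
qed

text \<open>The conjunct \<open>set_integrable\<close> expresses convergence of the improper
  integral and ensures that the \<open>LBINT\<close> value is a genuine integral over the box rather
  than a default value.\<close>

theorem theorem7p2:
  fixes a b c :: real
  assumes "a \<in> {0<..<1}" and "b \<in> {0<..<1}" and "c \<in> {0<..<1}"
  shows
    "(feasible (- 1) a b c \<longleftrightarrow> Delta (- 1) a b c \<ge> 0)
   \<and> (feasible (- 1) a b c \<longrightarrow> feasible 1 a b c)
   \<and> (Delta (- 1) a b c < 0 \<longrightarrow>
        (\<forall>n1\<in>sphere 0 1. \<forall>n2\<in>sphere 0 1. \<forall>n3\<in>sphere (0 :: real^3) 1.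
           \<bar>n1 \<bullet> n2\<bar> = a \<and> \<bar>n1 \<bullet> n3\<bar> = b \<and> \<bar>n2 \<bullet> n3\<bar> = c \<longrightarrow>
           sgn ((n1 \<bullet> n2) * (n1 \<bullet> n3) * (n2 \<bullet> n3)) = 1))
   \<and> (Delta (- 1) a b c \<ge> 0 \<longrightarrow>
        set_integrable lborel ({0..a} \<times> {0..b} \<times> {-c..c}) (\<lambda>(x, y, z). J_integrand x y z)
      \<and> J 1 a b c - J (- 1) a b c
          = 1 / (4 * pi) * (LBINT x=0..a. (LBINT y=0..b. (LBINT z=-c..c. J_integrand x y z)))
      \<and> J 1 a b c > J (- 1) a b c
      \<and> J 1 a b c - J (- 1) a b c \<ge> a * b * c / (2 * pi))
   \<and> (\<forall>n1\<in>sphere 0 1. \<forall>n2\<in>sphere 0 1. \<forall>n3\<in>sphere (0 :: real^3) 1.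
      \<forall>m1\<in>sphere 0 1. \<forall>m2\<in>sphere 0 1. \<forall>m3\<in>sphere (0 :: real^3) 1.
        \<bar>n1 \<bullet> n2\<bar> \<in> {0<..<1} \<and> \<bar>n1 \<bullet> n3\<bar> \<in> {0<..<1} \<and> \<bar>n2 \<bullet> n3\<bar> \<in> {0<..<1} \<and>
        (\<bar>n1 \<bullet> n2\<bar>, \<bar>n1 \<bullet> n3\<bar>, \<bar>n2 \<bullet> n3\<bar>, I3 n1 n2 n3)
          = (\<bar>m1 \<bullet> m2\<bar>, \<bar>m1 \<bullet> m3\<bar>, \<bar>m2 \<bullet> m3\<bar>, I3 m1 m2 m3) \<longrightarrow>
        sgn ((n1 \<bullet> n2) * (n1 \<bullet> n3) * (n2 \<bullet> n3)) = sgn ((m1 \<bullet> m2) * (m1 \<bullet> m3) * (m2 \<bullet> m3)))"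
proof -
  from assms have a: "0 < a" "a < 1" "\<bar>a\<bar> < 1" and b: "0 < b" "b < 1" and c: "0 < c" "c < 1" by auto
  have det: "gram_det a b (1 * c) = Delta 1 a b c" "gram_det a b (- 1 * c) = Delta (- 1) a b c"
    by (simp_all add: gram_det_def Delta_def)
  have feas: "feasible 1 a b c \<longleftrightarrow> Delta 1 a b c \<ge> 0" "feasible (- 1) a b c \<longleftrightarrow> Delta (- 1) a b c \<ge> 0"
    unfolding feasible_iff_gram_det[OF a(3)] det by (rule refl)+
  have "a * b * c > 0" using a b c by simp
  \<comment> \<open>The two determinants differ by \<open>4 * a * b * c\<close>.\<close>
  then have mono: "Delta (- 1) a b c \<le> Delta 1 a b c" by (simp add: Delta_def mult.assoc)
  have part3: "sgn ((n1 \<bullet> n2) * (n1 \<bullet> n3) * (n2 \<bullet> n3)) = 1"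
    if D: "Delta (- 1) a b c < 0" and n: "n1 \<in> sphere 0 1" "n2 \<in> sphere 0 1" "n3 \<in> sphere 0 1"
      and n_abs: "\<bar>n1 \<bullet> n2\<bar> = a" "\<bar>n1 \<bullet> n3\<bar> = b" "\<bar>n2 \<bullet> n3\<bar> = c" for n1 n2 n3 :: "real^3"
  proof -
    \<comment> \<open>A negative triangle sign would make \<open>Delta (- 1) a b c\<close> the Gram
      determinant of the triple, which is nonnegative.\<close>
    have "\<not> (n1 \<bullet> n2) * (n1 \<bullet> n3) * (n2 \<bullet> n3) < 0"
      using gram_det_unit_nonneg[of n1 n2 n3] gram_det_sign[OF n_abs] n n_abs(1) a(2) D by auto
    moreover have "(n1 \<bullet> n2) * (n1 \<bullet> n3) * (n2 \<bullet> n3) \<noteq> 0"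
      using n_abs a b c by auto
    ultimately show ?thesis by (simp add: sgn_if)
  qed
  have part4: "set_integrable lborel ({0..a} \<times> {0..b} \<times> {-c..c}) (\<lambda>(x, y, z). J_integrand x y z)
      \<and> J 1 a b c - J (- 1) a b c
          = 1 / (4 * pi) * (LBINT x=0..a. (LBINT y=0..b. (LBINT z=-c..c. J_integrand x y z)))
      \<and> J 1 a b c > J (- 1) a b c
      \<and> J 1 a b c - J (- 1) a b c \<ge> a * b * c / (2 * pi)" if D: "Delta (- 1) a b c \<ge> 0"
  proof -
    obtain n1 n2 n3 :: "real^3" where n: "n1 \<in> sphere 0 1" "n2 \<in> sphere 0 1" "n3 \<in> sphere 0 1"
      and n': "n1 \<bullet> n2 = a" "n1 \<bullet> n3 = b" "n2 \<bullet> n3 = 1 * c"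
      using exists_unit_triple[OF a(3), of b "1 * c"] D mono unfolding det by force
    obtain m1 m2 m3 :: "real^3" where m: "m1 \<in> sphere 0 1" "m2 \<in> sphere 0 1" "m3 \<in> sphere 0 1"
      and m': "m1 \<bullet> m2 = a" "m1 \<bullet> m3 = b" "m2 \<bullet> m3 = - 1 * c"
      using exists_unit_triple[OF a(3), of b "- 1 * c"] D unfolding det by force
    have abs: "\<bar>n1 \<bullet> n2\<bar> = a" "\<bar>n1 \<bullet> n3\<bar> = b" "\<bar>n2 \<bullet> n3\<bar> = c" "\<bar>m1 \<bullet> m2\<bar> = a" "\<bar>m1 \<bullet> m3\<bar> = b" "\<bar>m2 \<bullet> m3\<bar> = c"
      and sgn: "(n1 \<bullet> n2) * (n1 \<bullet> n3) * (n2 \<bullet> n3) > 0" "(m1 \<bullet> m2) * (m1 \<bullet> m3) * (m2 \<bullet> m3) < 0"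
      using a b c by (simp_all add: n' m' mult_neg_pos)
    show ?thesis
      using I3_sign_difference_real[OF n m abs sgn a(1) b(1) c D]
      unfolding J_eq_I3[OF n n'] J_eq_I3[OF m m'] by blast
  qed
  have part5: "sgn ((n1 \<bullet> n2) * (n1 \<bullet> n3) * (n2 \<bullet> n3)) = sgn ((m1 \<bullet> m2) * (m1 \<bullet> m3) * (m2 \<bullet> m3))"
    if n: "n1 \<in> sphere 0 1" "n2 \<in> sphere 0 1" "n3 \<in> sphere 0 1"
      and m: "m1 \<in> sphere 0 1" "m2 \<in> sphere 0 1" "m3 \<in> sphere 0 1"
      and range: "\<bar>n1 \<bullet> n2\<bar> \<in> {0<..<1}" "\<bar>n1 \<bullet> n3\<bar> \<in> {0<..<1}" "\<bar>n2 \<bullet> n3\<bar> \<in> {0<..<1}"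
      and eq: "\<bar>n1 \<bullet> n2\<bar> = \<bar>m1 \<bullet> m2\<bar>" "\<bar>n1 \<bullet> n3\<bar> = \<bar>m1 \<bullet> m3\<bar>" "\<bar>n2 \<bullet> n3\<bar> = \<bar>m2 \<bullet> m3\<bar>"
      and I: "I3 n1 n2 n3 = I3 m1 m2 m3" for n1 n2 n3 m1 m2 m3 :: "real^3"
  proof -
    let ?n = "(n1 \<bullet> n2) * (n1 \<bullet> n3) * (n2 \<bullet> n3)" and ?m = "(m1 \<bullet> m2) * (m1 \<bullet> m3) * (m2 \<bullet> m3)"
    have "\<bar>m1 \<bullet> m2\<bar> \<in> {0<..<1}" "\<bar>m1 \<bullet> m3\<bar> \<in> {0<..<1}" "\<bar>m2 \<bullet> m3\<bar> \<in> {0<..<1}"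
      using range by (simp_all only: eq)
    \<comment> \<open>Opposite signs, in either order, would make the two values of
      \<open>I3\<close> strictly different.\<close>
    then have "\<not> (?n > 0 \<and> ?m < 0)"
      using triangle_sign_determined[OF n m eq] I by auto
    moreover have "\<not> (?m > 0 \<and> ?n < 0)"
      using triangle_sign_determined[OF m n eq[symmetric] range] I by auto
    moreover have "?n \<noteq> 0" "?m \<noteq> 0" using range eq by auto
    ultimately show ?thesis by (metis sgn_pos sgn_neg linorder_neqE_linordered_idom)
  qed
  show ?thesis
  proof (intro conjI)
    show "feasible (- 1) a b c \<longrightarrow> feasible 1 a b c" using feas mono by auto
    show "feasible (- 1) a b c \<longleftrightarrow> Delta (- 1) a b c \<ge> 0" by (rule feas(2))
  next
    show "\<forall>n1\<in>sphere 0 1. \<forall>n2\<in>sphere 0 1. \<forall>n3\<in>sphere (0 :: real^3) 1.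
      \<forall>m1\<in>sphere 0 1. \<forall>m2\<in>sphere 0 1. \<forall>m3\<in>sphere (0 :: real^3) 1.
        \<bar>n1 \<bullet> n2\<bar> \<in> {0<..<1} \<and> \<bar>n1 \<bullet> n3\<bar> \<in> {0<..<1} \<and> \<bar>n2 \<bullet> n3\<bar> \<in> {0<..<1} \<and>
        (\<bar>n1 \<bullet> n2\<bar>, \<bar>n1 \<bullet> n3\<bar>, \<bar>n2 \<bullet> n3\<bar>, I3 n1 n2 n3)
          = (\<bar>m1 \<bullet> m2\<bar>, \<bar>m1 \<bullet> m3\<bar>, \<bar>m2 \<bullet> m3\<bar>, I3 m1 m2 m3) \<longrightarrow>
        sgn ((n1 \<bullet> n2) * (n1 \<bullet> n3) * (n2 \<bullet> n3)) = sgn ((m1 \<bullet> m2) * (m1 \<bullet> m3) * (m2 \<bullet> m3))"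
      unfolding prod.inject by (intro ballI impI, elim conjE, rule part5)
  qed (use part3 part4 in blast)+
qed

end
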